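(* Let $\{w_t\}_{t\ge 0}$ be i.i.d. random vectors in $\mathbb{R}^n$ with zero mean and covariance matrix $W$, and suppose the controller has $k\ge 1$ (exact) predictions. Then the optimal control policy (corresponding to the infinite-horizon average cost $\mathsf{STO}_k$) at each step $t$ is given by $$u_t = -(R + B^\top P B)^{-1} B^\top \left(P A x_t + \sum_{i=0}^{k-1} (A^\top - A^\top P H)^i P w_{t+i}\right),$$ where $P$ is the solution of the discrete-time algebraic Riccati equation $$P = Q + A^\top P A - A^\top P B(R + B^\top P B)^{-1} B^\top PA$$ and $H = B (R + B^\top P B)^{-1} B^\top$. The cost under this policy is $$\mathsf{STO}_k = \operatorname{Tr}\left[\left(P - \sum_{i=0}^{k-1} P (A - HPA)^i H (A^\top - A^\top PH)^i P\right) W\right].$$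
   Context: System and cost: $x_{t+1} = A x_t + B u_t + w_t$ with $x_t\in\mathbb{R}^n$, $u_t\in\mathbb{R}^d$, given initial state $x_0$, and for horizon $T\ge1$ the cost is $J = \sum_{t=0}^{T-1} (x_t^\top Q x_t + u_t^\top R u_t) + x_T^\top Q_f x_T$. Standing assumptions: $Q,Q_f\succeq 0$, $R\succ 0$ (symmetric); $(A,B)$ is stabilizable, i.e. there is $K_0$ with $\rho(A-BK_0)<1$ ($\rho$ = spectral radius); $(A,Q)$ is detectable, i.e. $(A^\top,Q)$ is stabilizable. "The solution" $P$ of the Riccati equation is its unique positive semidefinite solution. Predictions: with $k$ predictions, the controller chooses $u_t$ as an arbitrary (possibly nonlinear) function of $x_0,w_0,\dots,w_{t+k-1}$. The joint distribution of the disturbances is known to the controller. The optimal cost over horizon $T$ is $$\mathit{STO}^T_k = \mathbb{E}_{w_0,\dots,w_{k-1}} \Big( \min_{u_0} \Big( \mathbb{E}_{w_k} \Big( \cdots \min_{u_{T-k-1}} \Big( \mathbb{E}_{w_{T-1}} \Big( \min_{u_{T-k}, \dots, u_{T-1}} J \Big) \Big) \Big) \Big) \Big),$$ where each expectation over $w_t$ is with respect to its conditional distribution given $w_0,\dots,w_{t-1}$. The infinite-horizon average cost is $\mathsf{STO}_k=\lim_{T\to\infty}\frac1T \mathit{STO}^T_k$. A policy with $k$ predictions is optimal (corresponding to $\mathsf{STO}_k$) if its long-run average expected cost $\lim_{T\to\infty}\frac1T\mathbb{E}[J]$ equals $\mathsf{STO}_k$. *)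

theory Defs
  imports "HOL-Probability.Probability"
begin

definition pos_semidef :: "real^'n^'n \<Rightarrow> bool" where
  "pos_semidef M \<longleftrightarrow> transpose M = M \<and> (\<forall>x. 0 \<le> x \<bullet> (M *v x))"

definition pos_def :: "real^'n^'n \<Rightarrow> bool" where
  "pos_def M \<longleftrightarrow> transpose M = M \<and> (\<forall>x. x \<noteq> 0 \<longrightarrow> 0 < x \<bullet> (M *v x))"

definition complex_eigenvalues :: "real^'n^'n \<Rightarrow> complex set" where
  "complex_eigenvalues M =
     {l. \<exists>v. v \<noteq> 0 \<and> map_matrix complex_of_real M *v v = l *s v}"

definition spectral_radius :: "real^'n^'n \<Rightarrow> real" where
  "spectral_radius M = (SUP l\<in>complex_eigenvalues M. cmod l)"

definition stabilizable :: "real^'n^'n \<Rightarrow> real^'d^'n \<Rightarrow> bool" where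
  "stabilizable A B \<longleftrightarrow> (\<exists>K. spectral_radius (A - B ** K) < 1)"

definition detectable :: "real^'n^'n \<Rightarrow> real^'n^'n \<Rightarrow> bool" where
  "detectable A Q \<longleftrightarrow> stabilizable (transpose A) Q"

definition riccati_solution ::
  "real^'n^'n \<Rightarrow> real^'d^'n \<Rightarrow> real^'n^'n \<Rightarrow> real^'d^'d \<Rightarrow> real^'n^'n \<Rightarrow> bool" where
  "riccati_solution A B Q R P \<longleftrightarrow> pos_semidef P \<and>
     P = Q + transpose A ** P ** A
           - transpose A ** P ** B ** matrix_inv (R + transpose B ** P ** B) ** transpose B ** P ** A"

(* The power operation inherited by the vector type acts componentwise, so
   powers with respect to the matrix product are defined separately. *)
primrec mat_pow :: "real^'n^'n \<Rightarrow> nat \<Rightarrow> real^'n^'n" where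
  "mat_pow M 0 = mat 1"
| "mat_pow M (Suc i) = M ** mat_pow M i"

definition covariance_matrix :: "'a measure \<Rightarrow> ('a \<Rightarrow> real^'n) \<Rightarrow> real^'n^'n" where
  "covariance_matrix M X = (\<chi> i j. \<integral>\<omega>.
     (X \<omega> $ i - (\<integral>\<omega>'. X \<omega>' $ i \<partial>M)) * (X \<omega> $ j - (\<integral>\<omega>'. X \<omega>' $ j \<partial>M)) \<partial>M)"

primrec trajectory ::
  "real^'n^'n \<Rightarrow> real^'d^'n \<Rightarrow> real^'n \<Rightarrow> (nat \<Rightarrow> real^'d) \<Rightarrow> (nat \<Rightarrow> real^'n) \<Rightarrow> nat \<Rightarrow> real^'n" where
  "trajectory A B x0 u w 0 = x0"
| "trajectory A B x0 u w (Suc t) = A *v trajectory A B x0 u w t + B *v u t + w t"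

definition lqr_cost ::
  "real^'n^'n \<Rightarrow> real^'d^'n \<Rightarrow> real^'n^'n \<Rightarrow> real^'d^'d \<Rightarrow> real^'n^'n \<Rightarrow> real^'n \<Rightarrow>
   nat \<Rightarrow> (nat \<Rightarrow> real^'d) \<Rightarrow> (nat \<Rightarrow> real^'n) \<Rightarrow> real" where
  "lqr_cost A B Q R Qf x0 T u w =
     (let x = trajectory A B x0 u w in
      (\<Sum>t<T. x t \<bullet> (Q *v x t) + u t \<bullet> (R *v u t)) + x T \<bullet> (Qf *v x T))"

(* For independent disturbances with laws D t (so that D t is also the conditional law of
   w t given the past), nested_expectation D k F w is E_{w_0} (... E_{w_(k-1)} F);
   the entries w i with i < k of the argument w are overwritten. *)
primrec nested_expectation ::
  "(nat \<Rightarrow> 'v measure) \<Rightarrow> nat \<Rightarrow> ((nat \<Rightarrow> 'v) \<Rightarrow> ennreal) \<Rightarrow> (nat \<Rightarrow> 'v) \<Rightarrow> ennreal" where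
  "nested_expectation D 0 F w = F w"
| "nested_expectation D (Suc k) F w =
     nested_expectation D k (\<lambda>w'. \<integral>\<^sup>+ z. F (w'(k := z)) \<partial>D k) w"

(* With u_0, ..., u_(t-1) and w_0, ..., w_(t+k-1) already fixed, this is
     min_{u_t} E_{w_(t+k)} (... min_{u_(t+m-1)} E_{w_(t+k+m-1)} (min_{u_(t+m), u_(t+m+1), ...} J)).
   J is extended-nonnegative-valued, so that all infima and expectations are
   meaningful without integrability side conditions. *)
primrec nested_min ::
  "(nat \<Rightarrow> 'v measure) \<Rightarrow> nat \<Rightarrow> ((nat \<Rightarrow> 'c) \<Rightarrow> (nat \<Rightarrow> 'v) \<Rightarrow> ennreal) \<Rightarrow>
   nat \<Rightarrow> nat \<Rightarrow> (nat \<Rightarrow> 'c) \<Rightarrow> (nat \<Rightarrow> 'v) \<Rightarrow> ennreal" where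
  "nested_min D k J 0 t u w = (INF u'\<in>{u'. \<forall>i<t. u' i = u i}. J u' w)"
| "nested_min D k J (Suc m) t u w =
     (INF v. \<integral>\<^sup>+ z. nested_min D k J m (Suc t) (u(t := v)) (w(t + k := z)) \<partial>D (t + k))"

(* The optimal expected cost over horizon T with k predictions.  The initial sequences are
   irrelevant, since all entries that the cost depends on get overwritten.  For T < k all of
   w_0, ..., w_(T-1) are known before u_0 is chosen. *)
definition STO_horizon ::
  "real^'n^'n \<Rightarrow> real^'d^'n \<Rightarrow> real^'n^'n \<Rightarrow> real^'d^'d \<Rightarrow> real^'n^'n \<Rightarrow> real^'n \<Rightarrow>
   (nat \<Rightarrow> (real^'n) measure) \<Rightarrow> nat \<Rightarrow> nat \<Rightarrow> ennreal" where
  "STO_horizon A B Q R Qf x0 D k T =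
     nested_expectation D k
       (nested_min D k (\<lambda>u w. ennreal (lqr_cost A B Q R Qf x0 T u w)) (T - k) 0 (\<lambda>_. 0))
       (\<lambda>_. 0)"

(* Formulated in ereal rather than ennreal, so that c is not truncated at 0. *)
definition has_long_run_average :: "(nat \<Rightarrow> ennreal) \<Rightarrow> real \<Rightarrow> bool" where
  "has_long_run_average a c \<longleftrightarrow>
     (\<lambda>T. enn2ereal (a T) / ereal (real T)) \<longlonglongrightarrow> ereal c"

(* A policy (for a fixed initial state) maps the time and the disturbance sequence to an input. *)
type_synonym ('n, 'd) policy = "nat \<Rightarrow> (nat \<Rightarrow> real^'n) \<Rightarrow> real^'d"

definition uses_predictions :: "nat \<Rightarrow> ('n, 'd) policy \<Rightarrow> bool" where
  "uses_predictions k \<pi> \<longleftrightarrow>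
     (\<forall>t w w'. (\<forall>i<t + k. w i = w' i) \<longrightarrow> \<pi> t w = \<pi> t w')"

definition policy_cost ::
  "real^'n^'n \<Rightarrow> real^'d^'n \<Rightarrow> real^'n^'n \<Rightarrow> real^'d^'d \<Rightarrow> real^'n^'n \<Rightarrow> real^'n \<Rightarrow>
   'a measure \<Rightarrow> (nat \<Rightarrow> 'a \<Rightarrow> real^'n) \<Rightarrow> ('n, 'd) policy \<Rightarrow> nat \<Rightarrow> ennreal" where
  "policy_cost A B Q R Qf x0 M w \<pi> T =
     (\<integral>\<^sup>+ \<omega>. ennreal (lqr_cost A B Q R Qf x0 T (\<lambda>t. \<pi> t (\<lambda>i. w i \<omega>)) (\<lambda>i. w i \<omega>)) \<partial>M)"

definition optimal_policy ::
  "real^'n^'n \<Rightarrow> real^'d^'n \<Rightarrow> real^'n^'n \<Rightarrow> real^'d^'d \<Rightarrow> real^'n^'n \<Rightarrow> real^'n \<Rightarrow>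
   'a measure \<Rightarrow> (nat \<Rightarrow> 'a \<Rightarrow> real^'n) \<Rightarrow> nat \<Rightarrow> ('n, 'd) policy \<Rightarrow> bool" where
  "optimal_policy A B Q R Qf x0 M w k \<pi> \<longleftrightarrow> uses_predictions k \<pi> \<and>
     (\<exists>c. has_long_run_average (STO_horizon A B Q R Qf x0 (\<lambda>t. distr M borel (w t)) k) c \<and>
          has_long_run_average (policy_cost A B Q R Qf x0 M w \<pi>) c)"

(* A feedback law g gives the input g t x w in state x at time t under disturbances w. *)
primrec closed_loop_state ::
  "real^'n^'n \<Rightarrow> real^'d^'n \<Rightarrow> real^'n \<Rightarrow> (nat \<Rightarrow> real^'n \<Rightarrow> (nat \<Rightarrow> real^'n) \<Rightarrow> real^'d) \<Rightarrow>
   (nat \<Rightarrow> real^'n) \<Rightarrow> nat \<Rightarrow> real^'n" where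
  "closed_loop_state A B x0 g w 0 = x0"
| "closed_loop_state A B x0 g w (Suc t) =
     A *v closed_loop_state A B x0 g w t + B *v g t (closed_loop_state A B x0 g w t) w + w t"

definition feedback_policy ::
  "real^'n^'n \<Rightarrow> real^'d^'n \<Rightarrow> real^'n \<Rightarrow> (nat \<Rightarrow> real^'n \<Rightarrow> (nat \<Rightarrow> real^'n) \<Rightarrow> real^'d) \<Rightarrow>
   ('n, 'd) policy" where
  "feedback_policy A B x0 g t w = g t (closed_loop_state A B x0 g w t) w"

lemma trajectory_feedback_policy:
  "trajectory A B x0 (\<lambda>t. feedback_policy A B x0 g t w) w t = closed_loop_state A B x0 g w t"
  by (induction t) (simp_all add: feedback_policy_def)

lemma feedback_policy_eq:
  "feedback_policy A B x0 g t w =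
     g t (trajectory A B x0 (\<lambda>s. feedback_policy A B x0 g s w) w t) w"
  unfolding trajectory_feedback_policy by (simp only: feedback_policy_def)

end

theory Submission
  imports Defs "HOL-Computational_Algebra.Fundamental_Theorem_Algebra"
begin

text \<open>Let \<open>F = A - HPA\<close> be the closed-loop matrix, \<open>S = R + B\<^sup>T P B\<close>, and let
  \<open>y t = (\<Sum>i<k. (F\<^sup>T)^i P w (t + i))\<close> be the prediction term of the policy. Completing squares with
  the potential \<open>V t = x \<bullet> P x + 2 x \<bullet> F\<^sup>T y t\<close> turns the stage cost into
  \<open>V t - V (t + 1) + e \<bullet> S e + Z t + 2 (A x + B u) \<bullet> (F\<^sup>T)^k P w (t + k)\<close>, where the error \<open>e\<close> vanishes
  exactly for the stated policy, \<open>Z t\<close> depends on the noise only and has mean \<open>STO k\<close>, and the last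
  term has mean zero because \<open>w (t + k)\<close> is not yet known when \<open>u t\<close> is chosen. The terminal potential
  is negligible: for the policy because \<open>F\<close> is stable, and for the lower bound because detectability
  bounds the sum of all squared states by the cost, so that stopping at one of the last \<open>N\<close> times,
  averaged, costs only a fraction of order \<open>1/N\<close>.\<close>

section \<open>Stability of matrices\<close>

text \<open>The infima in \<open>nested_min\<close> range over arbitrary inputs, so the functions
  integrated there are not known to be measurable. Hence no integral of an infimum is ever computed:
  the lower bound replaces the cost by a pointwise minorant whose iterated integrals are explicit,
  the upper bound inserts one measurable policy, and only monotonicity of the nonnegative integral
  touches the infima. \<open>causal_sum\<close> captures the functions whose iterated mean is the
  same for all admissible inputs. Truncation at 0 by \<open>ennreal\<close> is harmless in a lower
  bound, and the upper bound works with majorants of a nonnegative cost.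

  The exact finite-horizon optimum would obey a Riccati recursion started at \<open>Qf\<close>,
  whose convergence to \<open>P\<close> would have to be proved. Using the stationary
  \<open>P\<close> at all times moves the whole discrepancy into one potential at the end. It grows
  like the square of the last state, which an input sequence may make large; this is why the lower
  bound has to average over end times. Detectability also yields the stability of \<open>F\<close>,
  through square summability of the noise-free closed loop.\<close>

lemma inner_matrix_vector:
  fixes M :: "real^'m^'n"
  shows "(M *v x) \<bullet> y = x \<bullet> (transpose M *v y)"
  by (metis dot_lmul_matrix transpose_matrix_vector transpose_transpose inner_commute)

lemma mat_pow_add: "mat_pow M (i + j) = mat_pow M i ** mat_pow M j"
  by (induction i) (auto simp: matrix_mul_assoc)

lemma mat_pow_Suc_right: "mat_pow M (Suc i) = mat_pow M i ** M"
  using mat_pow_add[of M i 1] by simp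

lemma transpose_mat_pow: "transpose (mat_pow M i) = mat_pow (transpose M) i"
proof (induction i)
  case (Suc i)
  have "transpose (mat_pow M (Suc i)) = transpose (mat_pow M i ** M)"
    by (simp only: mat_pow_Suc_right)
  also have "\<dots> = mat_pow (transpose M) (Suc i)"
    by (simp add: matrix_transpose_mul Suc)
  finally show ?case .
qed (simp add: transpose_mat)

text \<open>This is p(M) v by Horner's scheme. Only the action on one vector matters below, so no
  ring of matrix polynomials is set up.\<close>

definition poly_app :: "('a::field)^'n^'n \<Rightarrow> 'a poly \<Rightarrow> 'a^'n \<Rightarrow> 'a^'n" where
  "poly_app M p v = fold_coeffs (\<lambda>a w. a *s v + M *v w) p 0"

lemma poly_app_0 [simp]: "poly_app M 0 v = 0"
  by (simp add: poly_app_def)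

lemma poly_app_pCons [simp]: "poly_app M (pCons a p) v = a *s v + M *v poly_app M p v"
  by (cases "p = 0 \<and> a = 0") (auto simp: poly_app_def)

lemma poly_app_add: "poly_app M (p + q) v = poly_app M p v + poly_app M q v"
  by (induction p q rule: poly_induct2)
     (auto simp: matrix_vector_right_distrib vector_sadd_rdistrib algebra_simps)

lemma poly_app_smult: "poly_app M (smult c p) v = c *s poly_app M p v"
  by (induction p) (auto simp: vector_add_ldistrib vector_smult_assoc vector_scalar_commute
     )

lemma poly_app_monom: "poly_app M (monom c i) v = c *s (((*v) M ^^ i) v)"
  by (induction i) (auto simp: monom_0 monom_Suc vector_scalar_commute)

lemma poly_app_sum: "poly_app M (sum f I) v = (\<Sum>i\<in>I. poly_app M (f i) v)"
  by (induction I rule: infinite_finite_induct) (auto simp: poly_app_add)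

lemma poly_app_commute: "M *v poly_app M p v = poly_app M p (M *v v)"
  by (induction p) (auto simp: matrix_vector_right_distrib vector_scalar_commute)

lemma poly_app_linear_factor:
  "poly_app M ([:-l, 1:] * q) v = M *v poly_app M q v - l *s poly_app M q v"
proof -
  have "[:-l, 1:] * q = smult (-l) q + pCons 0 q" by simp
  thus ?thesis
    by (simp only: poly_app_add poly_app_smult poly_app_pCons)
       (simp add: vec_eq_iff)
qed

lemma poly_app_diff_scale:
  "poly_app M p (v - l *s w) = poly_app M p v - l *s poly_app M p w"
  by (induction p) (auto simp: vector_scalar_commute matrix_vector_mult_diff_distrib vector_ssub_ldistrib vector_smult_assoc
     vector_add_ldistrib mult.commute)

text \<open>With n the real dimension of the space, v, M v, ..., M^n v are too many vectors to be
  linearly independent. A polynomial annihilating a single vector suffices, so Cayley-Hamilton does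
  not enter.\<close>

lemma annihilating_poly_exists:
  fixes M :: "complex^'n^'n"
  shows "\<exists>p. p \<noteq> 0 \<and> poly_app M p v = 0"
proof -
  define f where "f i = ((*v) M ^^ i) v" for i
  define n where "n = DIM(complex^'n)"
  show ?thesis
  \<comment> \<open>Dependence is a property of the set of iterates and says nothing when two of
    them coincide; in that case a difference of two monomials annihilates \<open>v\<close>.\<close>
  proof (cases "inj_on f {..n}")
    case False
    then obtain i j where ij: "i \<noteq> j" "f i = f j" by (auto simp: inj_on_def)
    define p where "p = monom (1::complex) i + monom (-1) j"
    have "coeff p i = 1" using ij by (simp add: p_def)
    hence "p \<noteq> 0" by auto
    moreover have "poly_app M p v = 0"
      using ij by (simp add: p_def poly_app_add poly_app_monom f_def)
    ultimately show ?thesis by blast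
  next
    case True
    have "card (f ` {..n}) > DIM(complex^'n)"
      using True by (simp add: card_image n_def)
    hence "dependent (f ` {..n})" by (intro dependent_biggerset) auto
    then obtain c x where c: "x \<in> f ` {..n}" "c x \<noteq> 0" "(\<Sum>x\<in>f ` {..n}. c x *\<^sub>R x) = 0"
      by (auto simp: real_vector.dependent_finite)
    define p where "p = (\<Sum>i\<le>n. monom (complex_of_real (c (f i))) i)"
    obtain i where i: "i \<le> n" "x = f i" using c by auto
    have "coeff p i = c x"
      using i by (simp add: p_def coeff_sum)
    hence "p \<noteq> 0" using c(2) by auto
    moreover have "poly_app M p v = (\<Sum>i\<le>n. c (f i) *\<^sub>R f i)"
      by (auto simp: p_def poly_app_sum poly_app_monom f_def vec_eq_iff scaleR_conv_of_real[where 'a=complex]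
          intro!: sum.cong)
    hence "poly_app M p v = 0"
      using c(3) by (simp add: sum.reindex[OF True])
    ultimately show ?thesis by blast
  qed
qed

lemma affine_contraction_tendsto_0:
  fixes z s :: "nat \<Rightarrow> 'b::real_normed_vector"
  assumes s: "s \<longlonglongrightarrow> 0" and l: "0 \<le> l" "l < 1"
    and rec: "\<And>t. norm (z (Suc t)) \<le> l * norm (z t) + norm (s t)"
  shows "z \<longlonglongrightarrow> 0"
proof (rule LIMSEQ_I)
  fix e :: real assume e: "e > 0"
  \<comment> \<open>Makes e / 2 the fixed point of y -> l y + e', so the constant part of the bound
    reproduces itself.\<close>
  define e' where "e' = e / 2 * (1 - l)"
  have "e' > 0" using e l by (simp add: e'_def)
  then obtain n0 where n0: "\<And>t. t \<ge> n0 \<Longrightarrow> norm (s t) < e'"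
    using LIMSEQ_D[OF s] by fastforce
  have b: "norm (z (n0 + m)) \<le> l ^ m * norm (z n0) + e / 2" for m
  proof (induction m)
    case (Suc m)
    have "norm (z (n0 + Suc m)) \<le> l * norm (z (n0 + m)) + norm (s (n0 + m))"
      using rec by simp
    also have "\<dots> \<le> l * (l ^ m * norm (z n0) + e / 2) + e'"
      using Suc n0[of "n0 + m"] l by (intro add_mono mult_left_mono) auto
    also have "\<dots> = l ^ Suc m * norm (z n0) + e / 2"
      by (simp add: e'_def field_simps)
    finally show ?case .
  qed (use e in auto)
  have "(\<lambda>m. l ^ m * norm (z n0)) \<longlonglongrightarrow> 0"
    using l by (intro tendsto_mult_left_zero LIMSEQ_realpow_zero) auto
  then obtain m0 where m0: "\<And>m. m \<ge> m0 \<Longrightarrow> norm (l ^ m * norm (z n0)) < e / 2"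
    using LIMSEQ_D[of _ 0 "e/2"] e by fastforce
  show "\<exists>no. \<forall>n\<ge>no. norm (z n - 0) < e"
  proof (intro exI allI impI)
    fix n assume n: "n \<ge> n0 + m0"
    then obtain m where m: "n = n0 + m" "m \<ge> m0" by (metis le_Suc_ex le_add1 add_le_cancel_left le_trans)
    show "norm (z n - 0) < e"
      using b[of m] m0[of m] m by auto
  qed
qed

lemma norm_vector_smult: "norm (l *s y) = cmod l * norm y" for y :: "complex^'n"
  by (simp add: norm_vec_def L2_set_def norm_mult power_mult_distrib real_sqrt_mult
      flip: sum_distrib_left)

text \<open>Induction strips one root l of p = (X - l) q. If q(M) v = 0, the root is spurious and q
  takes over. Otherwise q(M) v is an eigenvector, so l has modulus below 1; the vector M v - l v is
  annihilated by q, its iterates vanish by induction, and those of v follow an l-contraction driven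
  by them. This replaces the Jordan form.\<close>

lemma poly_annihilated_iterates_tendsto_0:
  fixes M :: "complex^'n^'n"
  assumes ev: "\<And>l x. x \<noteq> 0 \<Longrightarrow> M *v x = l *s x \<Longrightarrow> cmod l < 1"
    and "p \<noteq> 0" "poly_app M p v = 0"
  shows "(\<lambda>t. ((*v) M ^^ t) v) \<longlonglongrightarrow> 0"
  using assms(2,3)
proof (induction "degree p" arbitrary: p v rule: less_induct)
  case (less p v)
  show ?case
  proof (cases "degree p = 0")
    case True
    then obtain a where "p = [:a:]" by (meson degree_eq_zeroE)
    hence "v = 0" using less.prems by simp
    hence "((*v) M ^^ t) v = 0" for t by (induction t) auto
    thus ?thesis by simp
  next
    case False
    hence "\<not> constant (poly p)" by (simp add: constant_degree)
    then obtain l where "poly p l = 0" using fundamental_theorem_of_algebra by blast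
    then obtain q where q: "p = [:-l, 1:] * q" by (metis dvdE poly_eq_0_iff_dvd)
    have q0: "q \<noteq> 0" using less.prems q by auto
    have deg: "degree q < degree p"
      unfolding q using q0 by (subst degree_mult_eq) auto
    define x where "x = poly_app M q v"
    have Mx: "M *v x = l *s x"
      using less.prems(2) unfolding q poly_app_linear_factor x_def by simp
    show ?thesis
    proof (cases "x = 0")
      case True
      thus ?thesis using less.hyps[OF deg q0] by (simp add: x_def)
    next
      case False
      hence l: "cmod l < 1" using ev Mx by blast
      define u where "u = M *v v - l *s v"
      have "poly_app M q u = M *v x - l *s x"
        by (simp add: u_def poly_app_diff_scale x_def poly_app_commute)
      hence "poly_app M q u = 0" using Mx by simp
      hence lim: "(\<lambda>t. ((*v) M ^^ t) u) \<longlonglongrightarrow> 0" using less.hyps[OF deg q0] by blast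
      have rec: "((*v) M ^^ Suc t) v = l *s ((*v) M ^^ t) v + ((*v) M ^^ t) u" for t
        by (induction t) (simp_all add: u_def matrix_vector_right_distrib vector_scalar_commute)
      show ?thesis
      proof (rule affine_contraction_tendsto_0[OF lim _ l])
        show "norm (((*v) M ^^ Suc t) v) \<le> cmod l * norm (((*v) M ^^ t) v) + norm (((*v) M ^^ t) u)" for t
        proof -
          show ?thesis unfolding rec norm_vector_smult[symmetric] by (rule norm_triangle_ineq)
        qed
      qed simp
    qed
  qed
qed

text \<open>\<open>spectral_radius\<close> is a supremum of reals and dominates its members only if
  the set is bounded above; the operator norm provides the bound.\<close>

lemma eigenvalue_norm_less_1:
  fixes M :: "real^'n^'n"
  assumes "spectral_radius M < 1" "v \<noteq> 0" "map_matrix complex_of_real M *v v = l *s v"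
  shows "cmod l < 1"
proof -
  let ?M = "map_matrix complex_of_real M"
  have "bdd_above (cmod ` complex_eigenvalues M)"
  proof (rule bdd_aboveI)
    fix c assume "c \<in> cmod ` complex_eigenvalues M"
    then obtain l x where x: "x \<noteq> 0" "?M *v x = l *s x" "c = cmod l"
      by (auto simp: complex_eigenvalues_def)
    have "c * norm x \<le> onorm ((*v) ?M) * norm x"
      using onorm[OF matrix_vector_mul_bounded_linear[of ?M], of x] x norm_vector_smult by metis
    thus "c \<le> onorm ((*v) ?M)" using x by simp
  qed
  moreover have "l \<in> complex_eigenvalues M" using assms by (auto simp: complex_eigenvalues_def)
  ultimately have "cmod l \<le> spectral_radius M" unfolding spectral_radius_def
    by (intro cSUP_upper)
  thus ?thesis using assms by simp
qed

lemma mat_pow_tendsto_0_if_spectral_radius: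
  fixes M :: "real^'n^'n"
  assumes "spectral_radius M < 1"
  shows "mat_pow M \<longlonglongrightarrow> 0"
proof -
  let ?M = "map_matrix complex_of_real M"
  define c :: "real^'n \<Rightarrow> complex^'n" where "c x = (\<chi> i. complex_of_real (x $ i))" for x
  have cM: "c (M *v x) = ?M *v c x" for x
    by (simp add: c_def matrix_vector_mult_def map_matrix_def vec_eq_iff)
  have it: "c (mat_pow M t *v x) = ((*v) ?M ^^ t) (c x)" for t x
    by (induction t) (auto simp: cM simp flip: matrix_vector_mul_assoc)
  have *: "(\<lambda>t. mat_pow M t *v x) \<longlonglongrightarrow> 0" for x
  proof (rule vec_tendstoI)
    fix i
    obtain p where "p \<noteq> 0" "poly_app ?M p (c x) = 0" using annihilating_poly_exists by blast
    hence "(\<lambda>t. ((*v) ?M ^^ t) (c x)) \<longlonglongrightarrow> 0"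
      using eigenvalue_norm_less_1[OF assms]
      by (intro poly_annihilated_iterates_tendsto_0) auto
    hence "(\<lambda>t. c (mat_pow M t *v x) $ i) \<longlonglongrightarrow> 0 $ i" unfolding it
      by (intro tendsto_vec_nth) 
    hence "(\<lambda>t. Re (c (mat_pow M t *v x) $ i)) \<longlonglongrightarrow> Re 0" by (intro tendsto_Re) simp
    thus "(\<lambda>t. (mat_pow M t *v x) $ i) \<longlonglongrightarrow> 0 $ i" by (simp add: c_def)
  qed
  show ?thesis
  proof (intro vec_tendstoI)
    fix i j
    have "(\<lambda>t. (mat_pow M t *v axis j 1) $ i) \<longlonglongrightarrow> 0 $ i" by (intro tendsto_vec_nth *)
    thus "(\<lambda>t. mat_pow M t $ i $ j) \<longlonglongrightarrow> 0 $ i $ j"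
      by (simp add: matrix_vector_mul_component inner_axis)
  qed
qed

lemma mat_pow_transpose_tendsto_0:
  fixes M :: "real^'n^'n"
  assumes "mat_pow M \<longlonglongrightarrow> 0"
  shows "mat_pow (transpose M) \<longlonglongrightarrow> 0"
proof (intro vec_tendstoI)
  fix i j
  have "(\<lambda>t. mat_pow M t $ j $ i) \<longlonglongrightarrow> 0 $ j $ i" by (intro tendsto_vec_nth assms)
  thus "(\<lambda>t. mat_pow (transpose M) t $ i $ j) \<longlonglongrightarrow> 0 $ i $ j"
    by (simp flip: transpose_mat_pow) (simp add: transpose_def)
qed

section \<open>Quantitative stability: contracting powers, Lyapunov functions and
  summability\<close>

lemma matrix_vector_norm_bound:
  fixes M :: "real^'m^'n"
  obtains c where "c \<ge> 0" "\<And>x. norm (M *v x) \<le> c * norm x"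
  using onorm[OF matrix_vector_mul_bounded_linear[of M]]
    onorm_pos_le[OF matrix_vector_mul_bounded_linear[of M]] by blast

text \<open>From here on stability is used only in the form that some power halves every norm. It
  can be reached from the spectral radius, as here, and from square summability of the
  orbits.\<close>

lemma mat_pow_contracts:
  fixes M :: "real^'n^'n"
  assumes "mat_pow M \<longlonglongrightarrow> 0"
  shows "\<exists>N. \<forall>x. norm (mat_pow M N *v x) \<le> norm x / 2"
proof -
  have "(\<lambda>t. \<Sum>i\<in>UNIV. \<Sum>j\<in>UNIV. \<bar>mat_pow M t $ i $ j\<bar>) \<longlonglongrightarrow>
      (\<Sum>i\<in>(UNIV::'n set). \<Sum>j\<in>(UNIV::'n set). \<bar>(0::real^'n^'n) $ i $ j\<bar>)"
    by (intro tendsto_intros assms)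
  from LIMSEQ_D[OF this, of "1/2"]
  have "\<exists>N. \<forall>t\<ge>N. norm (\<Sum>i\<in>UNIV. \<Sum>j\<in>UNIV. \<bar>mat_pow M t $ i $ j\<bar>) < 1/2"
    by simp
  then obtain N where "norm (\<Sum>i\<in>UNIV. \<Sum>j\<in>UNIV. \<bar>mat_pow M N $ i $ j\<bar>) < 1/2"
    by blast
  hence N: "(\<Sum>i\<in>UNIV. \<Sum>j\<in>UNIV. \<bar>mat_pow M N $ i $ j\<bar>) < 1/2"
    by simp
  have "onorm ((*v) (mat_pow M N)) \<le> 1/2"
    using onorm_le_matrix_component_sum[of "mat_pow M N"] N by linarith
  hence "norm (mat_pow M N *v x) \<le> 1/2 * norm x" for x
    using onorm[OF matrix_vector_mul_bounded_linear[of "mat_pow M N"], of x]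
    by (meson mult_right_mono norm_ge_zero order_trans)
  thus ?thesis by auto
qed

text \<open>The function \<open>L\<close> is the square of the adapted norm \<open>\<Sum>j<N. a^j \<cdot> norm (M^j x)\<close> with \<open>a^N = 2\<close>,
  which \<open>M\<close> contracts by the factor \<open>1/a\<close>.\<close>

lemma quadratic_lyapunov:
  fixes M :: "real^'n^'n"
  assumes contr: "\<And>x. norm (mat_pow M N *v x) \<le> norm x / 2"
  obtains L r c where "0 \<le> r" "r < 1" "c \<ge> 0"
    "\<And>x. (norm x)\<^sup>2 \<le> L x" "\<And>x. L x \<le> c * (norm x)\<^sup>2"
    "\<And>x v. L (M *v x + v) \<le> r * L x + c * (norm v)\<^sup>2"
proof -
  have N: "N > 0"
  proof (rule ccontr)
    assume "\<not> N > 0"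
    then show False using contr[of "axis undefined 1"] by simp
  qed
  define a where "a = root N 2"
  have a: "a > 1" "a ^ N = 2" using N by (auto simp: a_def)
  define l where "l x = (\<Sum>j<N. a ^ j * norm (mat_pow M j *v x))" for x
  have "\<exists>c\<ge>0. \<forall>x. norm (mat_pow M j *v x) \<le> c * norm x" for j
    using matrix_vector_norm_bound[of "mat_pow M j"] by blast
  then obtain d where d: "\<And>j. d j \<ge> 0" "\<And>j x. norm (mat_pow M j *v x) \<le> d j * norm x" by metis
  define c where "c = (\<Sum>j<N. a ^ j * d j)"
  have c: "c \<ge> 0" unfolding c_def using a d by (intro sum_nonneg mult_nonneg_nonneg) auto
  have up: "l x \<le> c * norm x" for x
    unfolding l_def c_def sum_distrib_right
    using d a by (intro sum_mono) (auto simp: mult.assoc)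
  have low: "norm x \<le> l x" for x
  proof -
    have "a ^ 0 * norm (mat_pow M 0 *v x) \<le> l x" unfolding l_def
      using N a by (intro member_le_sum) auto
    thus ?thesis by simp
  qed
  have tri: "l (x + y) \<le> l x + l y" for x y
    unfolding l_def sum.distrib[symmetric] distrib_left[symmetric] matrix_vector_right_distrib
    using a by (intro sum_mono mult_left_mono norm_triangle_ineq) auto
  have step: "l (M *v x) \<le> (1 / a) * l x" for x
  proof -
    \<comment> \<open>Multiplying by \<open>a\<close> shifts the index: the sum loses its term
      \<open>norm x\<close> at 0 and gains a term at N which, since a^N = 2, is twice a halved norm
      and so at most \<open>norm x\<close>.\<close>
    have "a * l (M *v x) = (\<Sum>j<N. a ^ Suc j * norm (mat_pow M (Suc j) *v x))"
      unfolding l_def sum_distrib_left mat_pow_Suc_right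
      by (simp add: mult.assoc matrix_vector_mul_assoc)
    also have "\<dots> = (\<Sum>j<Suc N. a ^ j * norm (mat_pow M j *v x)) - norm x"
      by (subst sum.lessThan_Suc_shift) simp
    also have "\<dots> = l x + 2 * norm (mat_pow M N *v x) - norm x"
      by (simp add: l_def a)
    also have "\<dots> \<le> l x" using contr[of x] by simp
    finally show ?thesis using a by (simp add: field_simps)
  qed
  define r where "r = 1 / a"
  have r: "0 < r" "r < 1" using a by (auto simp: r_def)
  have sq: "(l (M *v x + v))\<^sup>2 \<le> r * (l x)\<^sup>2 + (c\<^sup>2 / (1 - r)) * (norm v)\<^sup>2" for x v
  proof -
    have "l (M *v x + v) \<le> r * l x + c * norm v"
      using tri[of "M *v x" v] step[of x] up[of v] by (simp add: r_def)
    moreover have "0 \<le> l (M *v x + v)" using low norm_ge_zero order_trans by blast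
    ultimately have "(l (M *v x + v))\<^sup>2 \<le> (r * l x + c * norm v)\<^sup>2" by (intro power_mono) auto
    also have "\<dots> \<le> r * (l x)\<^sup>2 + (c\<^sup>2 / (1 - r)) * (norm v)\<^sup>2"
    proof -
      \<comment> \<open>Convexity of the square with weights r and 1 - r, with the defect exhibited
        as a square.\<close>
      have "r * (l x)\<^sup>2 + (c * norm v)\<^sup>2 / (1 - r) - (r * l x + c * norm v)\<^sup>2
          = r / (1 - r) * ((1 - r) * l x - c * norm v)\<^sup>2"
        using r by (simp add: divide_simps) (simp add: algebra_simps power2_eq_square)
      moreover have "\<dots> \<ge> 0" using r by simp
      ultimately show ?thesis by (simp add: power_mult_distrib)
    qed
    finally show ?thesis .
  qed
  define C where "C = max (c\<^sup>2) (c\<^sup>2 / (1 - r))"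
  show ?thesis
  proof (rule that[of r C "\<lambda>x. (l x)\<^sup>2"])
    show "(norm x)\<^sup>2 \<le> (l x)\<^sup>2" for x using low by (intro power_mono) auto
    show "(l x)\<^sup>2 \<le> C * (norm x)\<^sup>2" for x
    proof -
      have "(l x)\<^sup>2 \<le> (c * norm x)\<^sup>2" using up low by (metis norm_ge_zero order_trans power_mono)
      also have "\<dots> \<le> C * (norm x)\<^sup>2" unfolding power_mult_distrib C_def
        by (intro mult_right_mono) auto
      finally show ?thesis .
    qed
    show "(l (M *v x + v))\<^sup>2 \<le> r * (l x)\<^sup>2 + C * (norm v)\<^sup>2" for x v
      using sq[of x v] mult_right_mono[of "c\<^sup>2 / (1 - r)" C "(norm v)\<^sup>2"] by (auto simp: C_def)
  qed (use r in \<open>auto simp: C_def le_max_iff_disj\<close>)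
qed

text \<open>Summing the Lyapunov inequality telescopes \<open>L\<close>: each step loses at least 1
  - r times the squared state and gains at most c times the squared perturbation. The constant
  depends neither on the horizon nor on the perturbation.\<close>

lemma stable_sum_bound:
  fixes M :: "real^'n^'n"
  assumes "\<And>x. norm (mat_pow M N *v x) \<le> norm x / 2"
  obtains C where "C \<ge> 0" "\<And>x v T. (\<And>t. x (Suc t) = M *v x t + v t) \<Longrightarrow>
    (\<Sum>t<T. (norm (x t))\<^sup>2) \<le> C * ((norm (x 0))\<^sup>2 + (\<Sum>t<T. (norm (v t))\<^sup>2))"
proof -
  obtain L r c where L: "0 \<le> r" "r < 1" "c \<ge> 0"
    "\<And>x. (norm x)\<^sup>2 \<le> L x" "\<And>x. L x \<le> c * (norm x)\<^sup>2"
    "\<And>x v. L (M *v x + v) \<le> r * L x + c * (norm v)\<^sup>2"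
    using quadratic_lyapunov[OF assms] by metis
  show ?thesis
  proof (rule that[of "c / (1 - r)"])
    fix x v T assume rec: "\<And>t. x (Suc t) = M *v x t + v t"
    have "(1 - r) * (\<Sum>t<T. (norm (x t))\<^sup>2) + L (x T) \<le> L (x 0) + c * (\<Sum>t<T. (norm (v t))\<^sup>2)"
    proof (induction T)
      case (Suc T)
      have "(1 - r) * (norm (x T))\<^sup>2 \<le> (1 - r) * L (x T)" using L by (intro mult_left_mono) auto
      moreover have "L (x (Suc T)) \<le> r * L (x T) + c * (norm (v T))\<^sup>2" using L rec by simp
      ultimately show ?case using Suc by (simp add: algebra_simps)
    qed simp
    moreover have "L (x T) \<ge> 0" using L(4) by (meson order_trans zero_le_power2)
    ultimately have "(1 - r) * (\<Sum>t<T. (norm (x t))\<^sup>2) \<le> c * ((norm (x 0))\<^sup>2 + (\<Sum>t<T. (norm (v t))\<^sup>2))"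
      using L(5)[of "x 0"] by (simp add: algebra_simps)
    thus "(\<Sum>t<T. (norm (x t))\<^sup>2) \<le> c / (1 - r) * ((norm (x 0))\<^sup>2 + (\<Sum>t<T. (norm (v t))\<^sup>2))"
      using L by (simp add: field_simps)
  qed (use L in auto)
qed

text \<open>Datko's argument: M^T x is the image of each earlier M^t x under a uniformly bounded
  power, so T copies of its squared norm are bounded by C times the whole sum. Hence the squared
  norm of M^T decays like 1/T.\<close>

lemma square_summable_contracts:
  fixes M :: "real^'n^'n"
  assumes C: "\<And>x T. (\<Sum>t<T. (norm (mat_pow M t *v x))\<^sup>2) \<le> C * (norm x)\<^sup>2"
  shows "\<exists>N. \<forall>x. norm (mat_pow M N *v x) \<le> norm x / 2"
proof -
  have C1: "(norm (mat_pow M t *v x))\<^sup>2 \<le> C * (norm x)\<^sup>2" for t x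
  proof -
    have "(norm (mat_pow M t *v x))\<^sup>2 \<le> (\<Sum>s<Suc t. (norm (mat_pow M s *v x))\<^sup>2)"
      by (intro member_le_sum) auto
    thus ?thesis using C order_trans by blast
  qed
  have C0: "C \<ge> 0"
    using C1[of 0 "axis undefined 1"] by simp
  have C2: "real T * (norm (mat_pow M T *v x))\<^sup>2 \<le> C\<^sup>2 * (norm x)\<^sup>2" for T x
  proof -
    have "real T * (norm (mat_pow M T *v x))\<^sup>2 = (\<Sum>t<T. (norm (mat_pow M T *v x))\<^sup>2)" by simp
    also have "\<dots> \<le> (\<Sum>t<T. C * (norm (mat_pow M t *v x))\<^sup>2)"
    proof (intro sum_mono)
      fix t assume "t \<in> {..<T}"
      hence "mat_pow M T *v x = mat_pow M (T - t) *v (mat_pow M t *v x)"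
        by (simp add: matrix_vector_mul_assoc flip: mat_pow_add)
      thus "(norm (mat_pow M T *v x))\<^sup>2 \<le> C * (norm (mat_pow M t *v x))\<^sup>2" using C1 by metis
    qed
    also have "\<dots> \<le> C * (C * (norm x)\<^sup>2)"
      unfolding sum_distrib_left[symmetric] using C0 C by (intro mult_left_mono)
    finally show ?thesis by (simp add: power2_eq_square)
  qed
  \<comment> \<open>The multiple of C^2 by 4 yields the factor 1/4 for squared norms; the summand 1
    keeps T positive.\<close>
  obtain T where T: "real T \<ge> 4 * C\<^sup>2 + 1" using real_arch_simple by blast
  have T0: "real T > 0" using T zero_le_power2[of C] by linarith
  have "norm (mat_pow M T *v x) \<le> norm x / 2" for x
  proof -
    have "real T * (norm (mat_pow M T *v x))\<^sup>2 \<le> (real T / 4) * (norm x)\<^sup>2"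
      using C2[of T x] T mult_right_mono[of "C\<^sup>2" "real T / 4" "(norm x)\<^sup>2"] by simp
    hence "(norm (mat_pow M T *v x))\<^sup>2 \<le> (norm x / 2)\<^sup>2"
      using T0 by (simp add: power_divide)
    thus ?thesis by (rule power2_le_imp_le) simp
  qed
  thus ?thesis by blast
qed

section \<open>Nested minimisation and expectation\<close>

text \<open>With \<open>k\<close> predictions the inputs \<open>u i\<close> with \<open>i + k \<le> n\<close> are exactly those chosen before \<open>w n\<close> is
  revealed.\<close>

definition causal_term ::
  "nat \<Rightarrow> (nat \<Rightarrow> 'v measure) \<Rightarrow> nat \<Rightarrow> ((nat \<Rightarrow> 'c) \<Rightarrow> (nat \<Rightarrow> 'v) \<Rightarrow> real) \<Rightarrow> real \<Rightarrow> bool" where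
  "causal_term k D n f \<mu> \<longleftrightarrow>
     (\<forall>u u' w w'. (\<forall>i. i + k \<le> n \<longrightarrow> u i = u' i) \<longrightarrow> (\<forall>i\<le>n. w i = w' i) \<longrightarrow> f u w = f u' w') \<and>
     (\<forall>u w. integrable (D n) (\<lambda>z. f u (w(n := z))) \<and> (\<integral>z. f u (w(n := z)) \<partial>D n) = \<mu>)"

text \<open>A martingale-like decomposition: once everything before \<open>w n\<close> is fixed,
  term \<open>n\<close> has mean \<open>\<mu> n\<close>, whatever the past and the inputs are. So
  \<open>\<gamma>\<close> is the iterated mean under every choice of inputs with \<open>k\<close>
  predictions. Closure under linear combinations lets costs be assembled piecewise.\<close>

definition causal_sum ::
  "nat \<Rightarrow> (nat \<Rightarrow> 'v measure) \<Rightarrow> nat \<Rightarrow> ((nat \<Rightarrow> 'c) \<Rightarrow> (nat \<Rightarrow> 'v) \<Rightarrow> real) \<Rightarrow> real \<Rightarrow> bool" where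
  "causal_sum k D T g \<gamma> \<longleftrightarrow>
     (\<exists>f c \<mu>. (\<forall>n<T. causal_term k D n (f n) (\<mu> n)) \<and>
        (\<forall>u w. g u w = c + (\<Sum>n<T. f n u w)) \<and> \<gamma> = c + (\<Sum>n<T. \<mu> n))"

lemma causal_term_cong:
  assumes "causal_term k D n f \<mu>" "\<And>i. i + k \<le> n \<Longrightarrow> u i = u' i" "\<And>i. i \<le> n \<Longrightarrow> w i = w' i"
  shows "f u w = f u' w'"
  using assms unfolding causal_term_def by simp

lemma causal_term_zero: "causal_term k D n (\<lambda>u w. 0) 0"
  by (simp add: causal_term_def)

lemma causal_term_add:
  assumes "causal_term k D n f \<mu>" "causal_term k D n g \<nu>"
  shows "causal_term k D n (\<lambda>u w. f u w + g u w) (\<mu> + \<nu>)"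
proof -
  have "f u w + g u w = f u' w' + g u' w'"
    if "\<forall>i. i + k \<le> n \<longrightarrow> u i = u' i" "\<forall>i\<le>n. w i = w' i" for u u' w w'
    using assms that unfolding causal_term_def by metis
  thus ?thesis using assms unfolding causal_term_def by auto
qed

lemma causal_term_scale:
  assumes "causal_term k D n f \<mu>"
  shows "causal_term k D n (\<lambda>u w. a * f u w) (a * \<mu>)"
proof -
  have "a * f u w = a * f u' w'"
    if "\<forall>i. i + k \<le> n \<longrightarrow> u i = u' i" "\<forall>i\<le>n. w i = w' i" for u u' w w'
    using assms that unfolding causal_term_def by metis
  thus ?thesis using assms unfolding causal_term_def by auto
qed

lemma causal_sum_const: "causal_sum k D T (\<lambda>u w. c) c"
  unfolding causal_sum_def
  by (rule exI[of _ "\<lambda>n u w. 0"], rule exI[of _ c], rule exI[of _ "\<lambda>n. 0"])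
     (simp add: causal_term_zero)

lemma causal_sum_term:
  assumes "causal_term k D n f \<mu>" "n < T"
  shows "causal_sum k D T f \<mu>"
  unfolding causal_sum_def
  by (rule exI[of _ "\<lambda>i. if i = n then f else (\<lambda>u w. 0)"], rule exI[of _ 0],
      rule exI[of _ "\<lambda>i. if i = n then \<mu> else 0"])
     (use assms in \<open>auto simp: causal_term_zero if_distrib[of "\<lambda>f. f _"] cong: if_cong\<close>)

lemma causal_sum_add:
  assumes "causal_sum k D T f \<mu>" "causal_sum k D T g \<nu>"
  shows "causal_sum k D T (\<lambda>u w. f u w + g u w) (\<mu> + \<nu>)"
proof -
  obtain f' c \<mu>' where f: "\<forall>n<T. causal_term k D n (f' n) (\<mu>' n)"
      "\<And>u w. f u w = c + (\<Sum>n<T. f' n u w)" "\<mu> = c + (\<Sum>n<T. \<mu>' n)"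
    using assms(1) unfolding causal_sum_def by blast
  obtain g' d \<nu>' where g: "\<forall>n<T. causal_term k D n (g' n) (\<nu>' n)"
      "\<And>u w. g u w = d + (\<Sum>n<T. g' n u w)" "\<nu> = d + (\<Sum>n<T. \<nu>' n)"
    using assms(2) unfolding causal_sum_def by blast
  show ?thesis unfolding causal_sum_def
    by (rule exI[of _ "\<lambda>n u w. f' n u w + g' n u w"], rule exI[of _ "c + d"],
        rule exI[of _ "\<lambda>n. \<mu>' n + \<nu>' n"])
       (use f g in \<open>simp add: causal_term_add sum.distrib\<close>)
qed

lemma causal_sum_scale:
  assumes "causal_sum k D T f \<mu>"
  shows "causal_sum k D T (\<lambda>u w. a * f u w) (a * \<mu>)"
proof -
  obtain f' c \<mu>' where f: "\<forall>n<T. causal_term k D n (f' n) (\<mu>' n)"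
      "\<And>u w. f u w = c + (\<Sum>n<T. f' n u w)" "\<mu> = c + (\<Sum>n<T. \<mu>' n)"
    using assms(1) unfolding causal_sum_def by blast
  show ?thesis unfolding causal_sum_def
    by (rule exI[of _ "\<lambda>n u w. a * f' n u w"], rule exI[of _ "a * c"],
        rule exI[of _ "\<lambda>n. a * \<mu>' n"])
       (use f in \<open>simp add: causal_term_scale distrib_left sum_distrib_left\<close>)
qed

lemma causal_sum_diff:
  assumes "causal_sum k D T f \<mu>" "causal_sum k D T g \<nu>"
  shows "causal_sum k D T (\<lambda>u w. f u w - g u w) (\<mu> - \<nu>)"
  using causal_sum_add[OF assms(1) causal_sum_scale[OF assms(2), of "-1"]] by simp

lemma causal_sum_sum:
  assumes "\<And>i. i \<in> I \<Longrightarrow> causal_sum k D T (f i) (\<mu> i)"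
  shows "causal_sum k D T (\<lambda>u w. \<Sum>i\<in>I. f i u w) (\<Sum>i\<in>I. \<mu> i)"
  using assms
  by (induction I rule: infinite_finite_induct) (auto intro: causal_sum_const causal_sum_add)

text \<open>Term \<open>n\<close> sees the policy only through inputs \<open>i\<close> with i + k <=
  n, and these read noise strictly before \<open>w n\<close>; averaging over \<open>w n\<close> thus
  still gives \<open>\<mu> n\<close>. The result ignores \<open>u\<close>, whose type is therefore
  free.\<close>

lemma causal_sum_policy:
  assumes "causal_sum k D T g \<gamma>" "uses_predictions k \<pi>"
  shows "causal_sum k D T (\<lambda>(u :: nat \<Rightarrow> 'c) w. g (\<lambda>t. \<pi> t w) w) \<gamma>"
proof -
  obtain f c \<mu> where f: "\<forall>n<T. causal_term k D n (f n) (\<mu> n)"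
      "\<And>u w. g u w = c + (\<Sum>n<T. f n u w)" "\<gamma> = c + (\<Sum>n<T. \<mu> n)"
    using assms(1) unfolding causal_sum_def by blast
  have "causal_term k D n (\<lambda>(u :: nat \<Rightarrow> 'c) w. f n (\<lambda>t. \<pi> t w) w) (\<mu> n)" if n: "n < T" for n
  proof -
    have ct: "causal_term k D n (f n) (\<mu> n)" using f n by blast
    have pi: "\<pi> i w = \<pi> i w'" if "\<And>j. j < i + k \<Longrightarrow> w j = w' j" for i w w'
      using assms(2) that unfolding uses_predictions_def by blast
    have "f n (\<lambda>t. \<pi> t w) w = f n (\<lambda>t. \<pi> t w') w'" if "\<forall>i\<le>n. w i = w' i" for w w'
      by (rule causal_term_cong[OF ct]) (use that in \<open>auto intro!: pi\<close>)
    moreover have "f n (\<lambda>t. \<pi> t (w(n := z))) (w(n := z)) = f n (\<lambda>t. \<pi> t w) (w(n := z))" for w z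
      by (rule causal_term_cong[OF ct]) (auto intro!: pi)
    ultimately show ?thesis using ct unfolding causal_term_def by simp
  qed
  thus ?thesis unfolding causal_sum_def
    by (intro exI[of _ "\<lambda>n u w. f n (\<lambda>t. \<pi> t w) w"] exI[of _ c] exI[of _ \<mu>]) (use f in simp)
qed

section \<open>Causal sums as bounds for nested minima and expectations\<close>

lemma ennreal_integral_le_nn_integral:
  assumes "integrable N f"
  shows "ennreal (\<integral>x. f x \<partial>N) \<le> (\<integral>\<^sup>+x. ennreal (f x) \<partial>N)"
proof -
  \<comment> \<open>The positive part has the same image under \<open>ennreal\<close> as f itself;
    discarding the negative part is what costs equality.\<close>
  have "(\<integral>x. f x \<partial>N) \<le> (\<integral>x. max 0 (f x) \<partial>N)"
    using assms by (intro integral_mono) auto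
  hence "ennreal (\<integral>x. f x \<partial>N) \<le> ennreal (\<integral>x. max 0 (f x) \<partial>N)" by (rule ennreal_leI)
  also have "\<dots> = (\<integral>\<^sup>+x. ennreal (max 0 (f x)) \<partial>N)"
    using assms by (intro nn_integral_eq_integral[symmetric]) auto
  also have "\<dots> = (\<integral>\<^sup>+x. ennreal (f x) \<partial>N)"
    by (intro nn_integral_cong) (auto simp: max_def ennreal_neg)
  finally show ?thesis .
qed

lemma causal_term_step:
  assumes "causal_term k D n f \<mu>" "prob_space (D n)"
  shows "integrable (D n) (\<lambda>z. a + f u (w(n := z)))" "(\<integral>z. a + f u (w(n := z)) \<partial>D n) = a + \<mu>"
proof -
  interpret prob_space "D n" by fact
  show "integrable (D n) (\<lambda>z. a + f u (w(n := z)))" "(\<integral>z. a + f u (w(n := z)) \<partial>D n) = a + \<mu>"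
    using assms by (auto simp: causal_term_def prob_space)
qed

text \<open>Terms up to t + k - 1 are already determined; each later one is replaced by its mean,
  which no input can influence. The bound therefore holds for each candidate input separately and
  passes to the infimum.\<close>

lemma nested_min_ge:
  assumes D: "\<And>n. prob_space (D n)"
    and f: "\<And>n. n < T \<Longrightarrow> causal_term k D n (f n) (\<mu> n)"
    and J: "\<And>u w. ennreal (c + (\<Sum>n<T. f n u w)) \<le> J u w"
    and "t + k + m = T"
  shows "ennreal (c + (\<Sum>n<t+k. f n u w) + (\<Sum>n=t+k..<T. \<mu> n)) \<le> nested_min D k J m t u w"
  using assms(4)
proof (induction m arbitrary: t u w)
  case 0
  show ?case unfolding nested_min.simps
  proof (rule INF_greatest)
    fix u' assume u': "u' \<in> {u'. \<forall>i<t. u' i = u i}"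
    \<comment> \<open>Here t + k = T, so a term with n < T sees only inputs i with i + k <= n < t +
      k, which are fixed already. The final joint minimisation cannot lower the bound.\<close>
    have "f n u w = f n u' w" if "n < T" for n
      by (rule causal_term_cong[OF f[OF that]]) (use that 0 u' in auto)
    hence "(\<Sum>n<T. f n u w) = (\<Sum>n<T. f n u' w)" by (intro sum.cong) auto
    thus "ennreal (c + (\<Sum>n<t+k. f n u w) + (\<Sum>n=t+k..<T. \<mu> n)) \<le> J u' w"
      using J[of u' w] 0 by simp
  qed
next
  case (Suc m)
  define n where "n = t + k"
  have n: "n < T" using Suc.prems by (simp add: n_def)
  show ?case unfolding nested_min.simps
  proof (rule INF_greatest)
    fix v
    define u' where "u' = u(t := v)"
    define a where "a = c + (\<Sum>n<t+k. f n u w) + (\<Sum>n=Suc n..<T. \<mu> n)"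
    have eq: "f i u' (w(n := z)) = f i u w" if "i < n" for i z
      by (rule causal_term_cong[OF f]) (use that n in \<open>auto simp: u'_def n_def\<close>)
    have "(\<Sum>i=n..<T. \<mu> i) = \<mu> n + (\<Sum>i=Suc n..<T. \<mu> i)"
      using n by (simp add: sum.atLeast_Suc_lessThan)
    hence "ennreal (c + (\<Sum>n<t+k. f n u w) + (\<Sum>n=t+k..<T. \<mu> n)) = ennreal (a + \<mu> n)"
      by (simp add: a_def n_def algebra_simps)
    also have "\<dots> = ennreal (\<integral>z. a + f n u' (w(n := z)) \<partial>D n)"
      using causal_term_step(2)[OF f[OF n] D] by metis
    also have "\<dots> \<le> (\<integral>\<^sup>+z. ennreal (a + f n u' (w(n := z))) \<partial>D n)"
      by (intro ennreal_integral_le_nn_integral causal_term_step(1)[OF f[OF n] D])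
    also have "\<dots> \<le> (\<integral>\<^sup>+z. nested_min D k J m (Suc t) u' (w(n := z)) \<partial>D n)"
    proof (rule nn_integral_mono)
      fix z
      have "a + f n u' (w(n := z)) = c + (\<Sum>i<Suc t + k. f i u' (w(n := z))) + (\<Sum>i=Suc t+k..<T. \<mu> i)"
        by (simp add: a_def eq flip: n_def)
      moreover have "ennreal (c + (\<Sum>i<Suc t + k. f i u' (w(n := z))) + (\<Sum>i=Suc t+k..<T. \<mu> i))
          \<le> nested_min D k J m (Suc t) u' (w(n := z))"
        by (rule Suc.IH) (use Suc.prems in simp)
      ultimately show "ennreal (a + f n u' (w(n := z))) \<le> nested_min D k J m (Suc t) u' (w(n := z))"
        by (simp only:)
    qed
    finally show "ennreal (c + (\<Sum>n<t+k. f n u w) + (\<Sum>n=t+k..<T. \<mu> n))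
      \<le> (\<integral>\<^sup>+z. nested_min D k J m (Suc t) (u(t := v)) (w(t + k := z)) \<partial>D (t + k))"
      by (simp add: u'_def n_def)
  qed
qed

lemma nested_expectation_ge:
  assumes D: "\<And>n. prob_space (D n)"
    and f: "\<And>n. n < j \<Longrightarrow> causal_term k D n (f n) (\<mu> n)"
    and F: "\<And>w. ennreal (c + (\<Sum>n<j. f n u w)) \<le> F w"
  shows "ennreal (c + (\<Sum>n<j. \<mu> n)) \<le> nested_expectation D j F w"
  using f F
proof (induction j arbitrary: F c)
  case (Suc j)
  have "ennreal (c + \<mu> j + (\<Sum>n<j. f n u w)) \<le> (\<integral>\<^sup>+ z. F (w(j := z)) \<partial>D j)" for w
  proof -
    let ?a = "c + (\<Sum>n<j. f n u w)"
    have eq: "f i u (w(j := z)) = f i u w" if "i < j" for i z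
      by (rule causal_term_cong[OF Suc.prems(1)]) (use that in auto)
    have eq': "c + (\<Sum>n<Suc j. f n u (w(j := z))) = ?a + f j u (w(j := z))" for z
      by (simp add: eq add.assoc)
    have "ennreal (c + \<mu> j + (\<Sum>n<j. f n u w)) = ennreal (?a + \<mu> j)" by (simp add: algebra_simps)
    also have "\<dots> = ennreal (\<integral>z. ?a + f j u (w(j := z)) \<partial>D j)"
      using causal_term_step(2)[OF Suc.prems(1) D] by (metis lessI)
    also have "\<dots> \<le> (\<integral>\<^sup>+z. ennreal (?a + f j u (w(j := z))) \<partial>D j)"
      by (intro ennreal_integral_le_nn_integral causal_term_step(1)[OF Suc.prems(1) D]) simp
    also have "\<dots> \<le> (\<integral>\<^sup>+ z. F (w(j := z)) \<partial>D j)"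
    proof (rule nn_integral_mono)
      fix z show "ennreal (?a + f j u (w(j := z))) \<le> F (w(j := z))"
        using Suc.prems(2)[of "w(j := z)"] unfolding eq' .
    qed
    finally show ?thesis .
  qed
  hence "ennreal (c + \<mu> j + (\<Sum>n<j. \<mu> n)) \<le> nested_expectation D j (\<lambda>w. \<integral>\<^sup>+ z. F (w(j := z)) \<partial>D j) w"
    by (rule Suc.IH[rotated]) (rule Suc.prems(1), simp)
  thus ?case by (simp add: add.assoc add.commute)
qed simp

lemma nested_expectation_mono:
  assumes "\<And>w. F w \<le> G w"
  shows "nested_expectation D j F w \<le> nested_expectation D j G w"
  using assms
proof (induction j arbitrary: F G)
  case (Suc j)
  show ?case unfolding nested_expectation.simps
    by (intro Suc.IH nn_integral_mono Suc.prems)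
qed simp

text \<open>Nonnegativity makes the truncation by \<open>ennreal\<close> inactive, and it survives
  every integration, which is why it is carried along as a conjunct of the induction.\<close>

lemma nested_expectation_eq:
  assumes D: "\<And>n. prob_space (D n)"
    and f: "\<And>n. n < j \<Longrightarrow> causal_term k D n (f n) (\<mu> n)"
    and nonneg: "\<And>w. 0 \<le> c + (\<Sum>n<j. f n u w)"
  shows "0 \<le> c + (\<Sum>n<j. \<mu> n) \<and>
    nested_expectation D j (\<lambda>w. ennreal (c + (\<Sum>n<j. f n u w))) w = ennreal (c + (\<Sum>n<j. \<mu> n))"
  using f nonneg
proof (induction j arbitrary: c)
  case (Suc j)
  have *: "0 \<le> c + \<mu> j + (\<Sum>n<j. f n u w) \<and>
     (\<integral>\<^sup>+ z. ennreal (c + (\<Sum>n<Suc j. f n u (w(j := z)))) \<partial>D j) =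
     ennreal (c + \<mu> j + (\<Sum>n<j. f n u w))" for w
  proof -
    let ?a = "c + (\<Sum>n<j. f n u w)"
    have eq: "f i u (w(j := z)) = f i u w" if "i < j" for i z
      by (rule causal_term_cong[OF Suc.prems(1)]) (use that in auto)
    have eq': "c + (\<Sum>n<Suc j. f n u (w(j := z))) = ?a + f j u (w(j := z))" for z
      by (simp add: eq add.assoc)
    have int: "(\<integral>z. ?a + f j u (w(j := z)) \<partial>D j) = ?a + \<mu> j"
      by (rule causal_term_step(2)[OF Suc.prems(1) D]) simp
    have nn: "0 \<le> ?a + f j u (w(j := z))" for z
      using Suc.prems(2)[of "w(j := z)"] unfolding eq' .
    have "0 \<le> ?a + \<mu> j" unfolding int[symmetric] using nn by simp
    moreover have "(\<integral>\<^sup>+ z. ennreal (c + (\<Sum>n<Suc j. f n u (w(j := z)))) \<partial>D j) = ennreal (?a + \<mu> j)"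
      unfolding eq' int[symmetric]
      by (intro nn_integral_eq_integral causal_term_step(1)[OF Suc.prems(1) D] AE_I2 nn) simp
    ultimately show ?thesis by (simp add: algebra_simps)
  qed
  have "nested_expectation D (Suc j) (\<lambda>w. ennreal (c + (\<Sum>n<Suc j. f n u w))) w =
    nested_expectation D j (\<lambda>w. ennreal (c + \<mu> j + (\<Sum>n<j. f n u w))) w"
    unfolding nested_expectation.simps using * by simp
  moreover have "0 \<le> c + \<mu> j + (\<Sum>n<j. \<mu> n) \<and> nested_expectation D j (\<lambda>w. ennreal (c + \<mu> j + (\<Sum>n<j. f n u w))) w =
      ennreal (c + \<mu> j + (\<Sum>n<j. \<mu> n))"
    by (rule Suc.IH) (use * Suc.prems(1) in auto)
  ultimately show ?case by (simp add: add.assoc add.commute)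
qed simp

lemma STO_horizon_ge:
  fixes D :: "nat \<Rightarrow> (real^'n) measure" and B :: "real^'d^'n"
  assumes D: "\<And>n. prob_space (D n)"
    and "causal_sum k D T g \<gamma>"
    and J: "\<And>u w. g u w \<le> lqr_cost A B Q R Qf x0 T u w"
    and "k \<le> T"
  shows "ennreal \<gamma> \<le> STO_horizon A B Q R Qf x0 D k T"
proof -
  obtain f c \<mu> where f: "\<And>n. n<T \<Longrightarrow> causal_term k D n (f n) (\<mu> n)"
      "\<And>u w. g u w = c + (\<Sum>n<T. f n u w)" "\<gamma> = c + (\<Sum>n<T. \<mu> n)"
    using assms(2) unfolding causal_sum_def by blast
  have "ennreal (c + (\<Sum>n=k..<T. \<mu> n) + (\<Sum>n<k. \<mu> n)) \<le> STO_horizon A B Q R Qf x0 D k T"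
    unfolding STO_horizon_def
  proof (rule nested_expectation_ge[OF D])
    show "causal_term k D n (f n) (\<mu> n)" if "n < k" for n using f that assms by simp
    fix w
    have "ennreal (c + (\<Sum>n<0+k. f n (\<lambda>_. 0) w) + (\<Sum>n=0+k..<T. \<mu> n)) \<le>
      nested_min D k (\<lambda>u w. ennreal (lqr_cost A B Q R Qf x0 T u w)) (T - k) 0 (\<lambda>_. 0) w"
      using assms J f(2) by (intro nested_min_ge[OF D f(1)]) (auto intro!: ennreal_leI)
    thus "ennreal (c + (\<Sum>n=k..<T. \<mu> n) + (\<Sum>n<k. f n (\<lambda>_. 0) w)) \<le>
      nested_min D k (\<lambda>u w. ennreal (lqr_cost A B Q R Qf x0 T u w)) (T - k) 0 (\<lambda>_. 0) w"
      by (simp add: algebra_simps)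
  qed
  moreover have "(\<Sum>n<T. \<mu> n) = (\<Sum>n<k. \<mu> n) + (\<Sum>n=k..<T. \<mu> n)"
    using assms(4) by (metis sum.atLeastLessThan_concat atLeast0LessThan zero_le)
  ultimately show ?thesis using f(3) by (simp add: algebra_simps)
qed

section \<open>Iterated integrals along a fixed policy\<close>

primrec iter_expectation ::
  "(nat \<Rightarrow> 'v measure) \<Rightarrow> nat \<Rightarrow> nat \<Rightarrow> ((nat \<Rightarrow> 'v) \<Rightarrow> ennreal) \<Rightarrow> (nat \<Rightarrow> 'v) \<Rightarrow> ennreal" where
  "iter_expectation D 0 j F w = F w"
| "iter_expectation D (Suc m) j F w =
     (\<integral>\<^sup>+ z. iter_expectation D m (Suc j) F (w(j := z)) \<partial>D j)"

text \<open>Both notions integrate in the same order, earliest noise outermost.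
  \<open>nested_expectation\<close> unfolds from the inside, \<open>iter_expectation\<close> from
  the outside and hence in step with \<open>nested_min\<close>. No integrals are exchanged, so
  \<open>F\<close> may be arbitrary.\<close>

lemma nested_expectation_iter:
  "nested_expectation D j (iter_expectation D m j F) w = nested_expectation D (j + m) F w"
proof (induction m arbitrary: j)
  case (Suc m)
  have "nested_expectation D j (iter_expectation D (Suc m) j F) w =
     nested_expectation D (Suc j) (iter_expectation D m (Suc j) F) w"
    unfolding nested_expectation.simps(2)
    by (rule arg_cong[of _ _ "\<lambda>G. nested_expectation D j G w"]) (simp add: fun_eq_iff)
  also have "\<dots> = nested_expectation D (Suc j + m) F w" by (rule Suc)
  finally show ?case by (simp only: add_Suc add_Suc_right)
next
  case 0
  have "iter_expectation D 0 j F = F" by auto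
  thus ?case by simp
qed

lemma iter_expectation_ge:
  assumes D: "\<And>n. prob_space (D n)"
    and "\<And>w'. (\<And>i. i < j \<Longrightarrow> w' i = w i) \<Longrightarrow> a \<le> F w'"
  shows "a \<le> iter_expectation D m j F w"
  using assms(2)
proof (induction m arbitrary: j w)
  case (Suc m)
  interpret prob_space "D j" by fact
  have "a = (\<integral>\<^sup>+ z. a \<partial>D j)" by (simp add: emeasure_space_1)
  also have "\<dots> \<le> (\<integral>\<^sup>+ z. iter_expectation D m (Suc j) F (w(j := z)) \<partial>D j)"
    by (intro nn_integral_mono Suc.IH Suc.prems) auto
  finally show ?case by simp
qed simp

text \<open>The additional \<open>l\<close> integrations are needed because a policy may use predictions of noise
  beyond the horizon \<open>T\<close>.\<close>

lemma nested_min_le_policy: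
  assumes D: "\<And>n. prob_space (D n)"
    and J: "\<And>u w w'. (\<And>i. i < T \<Longrightarrow> w i = w' i) \<Longrightarrow> J u w = J u w'"
    and \<pi>: "uses_predictions k \<pi>"
    and "t + k + m = T" and "\<And>i. i < t \<Longrightarrow> u i = \<pi> i w"
  shows "nested_min D k J m t u w \<le> iter_expectation D (m + l) (t + k) (\<lambda>w. J (\<lambda>i. \<pi> i w) w) w"
  using assms(4,5)
proof (induction m arbitrary: t u w)
  case 0
  have *: "nested_min D k J 0 t u w \<le> J (\<lambda>i. \<pi> i w') w'" if "\<And>i. i < t + k \<Longrightarrow> w' i = w i" for w'
  proof -
    have "\<pi> i w' = u i" if "i < t" for i
    proof -
      have "\<pi> i w' = \<pi> i w"
        using \<pi> \<open>i < t\<close> \<open>\<And>i. i < t + k \<Longrightarrow> w' i = w i\<close> unfolding uses_predictions_def by simp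
      thus ?thesis using 0 that by simp
    qed
    hence "nested_min D k J 0 t u w \<le> J (\<lambda>i. \<pi> i w') w" by (auto intro: INF_lower)
    also have "\<dots> = J (\<lambda>i. \<pi> i w') w'" using that 0 by (intro J) auto
    finally show ?thesis .
  qed
  show ?case by (rule iter_expectation_ge[OF D]) (rule *)
next
  case (Suc m)
  have "nested_min D k J (Suc m) t u w \<le>
    (\<integral>\<^sup>+ z. nested_min D k J m (Suc t) (u(t := \<pi> t w)) (w(t + k := z)) \<partial>D (t + k))"
    by (auto intro: INF_lower)
  also have "\<dots> \<le> (\<integral>\<^sup>+ z. iter_expectation D (m + l) (Suc t + k) (\<lambda>w. J (\<lambda>i. \<pi> i w) w) (w(t + k := z)) \<partial>D (t + k))"
  proof (intro nn_integral_mono Suc.IH)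
    fix z i assume "i < Suc t"
    hence "\<pi> i (w(t + k := z)) = \<pi> i w"
      using \<pi> unfolding uses_predictions_def by auto
    thus "(u(t := \<pi> t w)) i = \<pi> i (w(t + k := z))" using Suc.prems \<open>i < Suc t\<close> by auto
  qed (use Suc.prems in auto)
  finally show ?case by simp
qed

text \<open>The last noise is integrated out first. By independence the joint law of the first n
  noises and \<open>w n\<close> is a product, so Fubini turns the inner integral into part of the
  expectation over \<open>M\<close>. Applied only to the cost of one measurable policy.\<close>

lemma nested_expectation_eq_nn_integral:
  fixes w :: "nat \<Rightarrow> 'a \<Rightarrow> 'v::topological_space"
  assumes M: "prob_space M"
    and ind: "prob_space.indep_vars M (\<lambda>_. borel) w UNIV"
    and "F \<in> borel_measurable (PiM UNIV (\<lambda>_. borel))"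
    and "\<And>v v'. (\<And>i. i < n \<Longrightarrow> v i = v' i) \<Longrightarrow> F v = F v'"
  shows "nested_expectation (\<lambda>t. distr M borel (w t)) n F v = (\<integral>\<^sup>+ \<omega>. F (\<lambda>i. w i \<omega>) \<partial>M)"
  using assms(3,4)
proof (induction n arbitrary: F)
  case 0
  interpret prob_space M by fact
  have "F = (\<lambda>_. F v)" using 0(2) by blast
  then have "(\<integral>\<^sup>+ \<omega>. F (\<lambda>i. w i \<omega>) \<partial>M) = (\<integral>\<^sup>+ \<omega>. F v \<partial>M)" by metis
  then show ?case by (simp add: emeasure_space_1)
next
  case (Suc n)
  interpret prob_space M by fact
  have wm[measurable]: "w i \<in> measurable M borel" for i
    using ind by (simp add: indep_vars_def2)
  let ?D = "distr M borel (w n)"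
  interpret D: prob_space ?D by (rule prob_space_distr) simp
  note [measurable] = Suc.prems(1)
  define S where "S = PiM {..<n} (\<lambda>_. borel :: 'v measure)"
  define F' where "F' v = (\<integral>\<^sup>+ z. F (v(n := z)) \<partial>?D)" for v
  have upd[measurable]: "(\<lambda>x. (fst x)(n := snd x)) \<in> measurable (PiM UNIV (\<lambda>_. borel) \<Otimes>\<^sub>M ?D) (PiM UNIV (\<lambda>_. borel :: 'v measure))"
    by (rule measurable_fun_upd[where J = UNIV]) (auto simp: measurable_distr_eq2)
  have "F' \<in> borel_measurable (PiM UNIV (\<lambda>_. borel))"
    unfolding F'_def
    by (rule D.borel_measurable_nn_integral)
       (use measurable_compose[OF upd Suc.prems(1)] in \<open>simp add: case_prod_beta'\<close>)
  moreover have "F' v = F' v'" if "\<And>i. i < n \<Longrightarrow> v i = v' i" for v v'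
    unfolding F'_def using that by (intro nn_integral_cong Suc.prems(2)) auto
  ultimately have IH: "nested_expectation (\<lambda>t. distr M borel (w t)) n F' v = (\<integral>\<^sup>+ \<omega>. F' (\<lambda>i. w i \<omega>) \<partial>M)"
    by (rule Suc.IH)
  define X where "X \<omega> = restrict (\<lambda>i. w i \<omega>) {..<n}" for \<omega>
  \<comment> \<open>Independence speaks about products over the index sets \<open>{..<n}\<close> and
    \<open>{n}\<close>, while \<open>F\<close> takes full sequences. \<open>e\<close> pads with
    \<open>undefined\<close>: the entry at n is overwritten and \<open>F\<close> ignores the later
    ones.\<close>
  define e :: "(nat \<Rightarrow> 'v) \<Rightarrow> nat \<Rightarrow> 'v" where "e x = (\<lambda>i. if i < n then x i else undefined)" for x
  have e: "e \<in> measurable S (PiM UNIV (\<lambda>_. borel))"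
    unfolding e_def S_def
  proof (rule measurable_PiM_single')
    show "(\<lambda>x. if i < n then x i else undefined) \<in> measurable (PiM {..<n} (\<lambda>_. borel)) (borel :: 'v measure)" for i
      by (cases "i < n") auto
  qed auto
  define S' where "S' = PiM {n} (\<lambda>_. borel :: 'v measure)"
  define Y where "Y \<omega> = restrict (\<lambda>i. w i \<omega>) {n}" for \<omega>
  have iv: "indep_var S X S' Y"
    unfolding S_def X_def[abs_def] S'_def Y_def[abs_def] by (rule indep_var_restrict[OF ind]) auto
  have Xm[measurable]: "X \<in> measurable M S" and Ym[measurable]: "Y \<in> measurable M S'" and
    dist: "distr M S X \<Otimes>\<^sub>M distr M S' Y = distr M (S \<Otimes>\<^sub>M S') (\<lambda>\<omega>. (X \<omega>, Y \<omega>))"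
    using iv unfolding indep_var_distribution_eq by auto
  interpret Y: prob_space "distr M S' Y" by (rule prob_space_distr) simp
  have n_comp[measurable]: "(\<lambda>y. y n) \<in> measurable S' borel" by (simp add: S'_def)
  have G: "(\<lambda>x. F ((e (fst x))(n := snd x n))) \<in> borel_measurable (S \<Otimes>\<^sub>M S')"
    by (rule measurable_compose[OF _ Suc.prems(1)], rule measurable_fun_upd[where J = UNIV])
       (auto intro: measurable_compose[OF measurable_fst e] measurable_compose[OF measurable_snd n_comp])
  have Xe: "F ((e (X \<omega>))(n := z)) = F ((\<lambda>i. w i \<omega>)(n := z))" for \<omega> z
    by (rule Suc.prems(2)) (auto simp: e_def X_def)
  have Dn: "(\<integral>\<^sup>+ z. F ((e x)(n := z)) \<partial>?D) = (\<integral>\<^sup>+ y. F ((e x)(n := y n)) \<partial>distr M S' Y)" for x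
  proof -
    have "(\<lambda>z. F ((e x)(n := z))) \<in> borel_measurable borel"
      by (rule measurable_compose[OF _ Suc.prems(1)], rule measurable_fun_upd[where J = UNIV])
         (auto simp: space_PiM)
    thus ?thesis by (subst (1 2) nn_integral_distr) (auto simp: Y_def)
  qed
  have "(\<integral>\<^sup>+ \<omega>. F' (\<lambda>i. w i \<omega>) \<partial>M) = (\<integral>\<^sup>+ \<omega>. \<integral>\<^sup>+ y. F ((e (X \<omega>))(n := y n)) \<partial>distr M S' Y \<partial>M)"
    unfolding F'_def Xe[symmetric] Dn ..
  also have "\<dots> = (\<integral>\<^sup>+ x. \<integral>\<^sup>+ y. F ((e x)(n := y n)) \<partial>distr M S' Y \<partial>distr M S X)"
  proof (rule nn_integral_distr[symmetric])
    show "(\<lambda>x. \<integral>\<^sup>+ y. F ((e x)(n := y n)) \<partial>distr M S' Y) \<in> borel_measurable (distr M S X)"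
      by (rule Y.borel_measurable_nn_integral) (use G in \<open>simp add: case_prod_beta'\<close>)
  qed simp
  also have "\<dots> = (\<integral>\<^sup>+ x. F ((e (fst x))(n := snd x n)) \<partial>(distr M S X \<Otimes>\<^sub>M distr M S' Y))"
  proof -
    have "(\<lambda>x. F ((e (fst x))(n := snd x n))) \<in> borel_measurable (distr M S X \<Otimes>\<^sub>M distr M S' Y)"
      using G by simp
    from Y.nn_integral_fst[OF this] show ?thesis by simp
  qed
  also have "\<dots> = (\<integral>\<^sup>+ \<omega>. F ((e (X \<omega>))(n := Y \<omega> n)) \<partial>M)"
    unfolding dist by (subst nn_integral_distr) (use G in auto)
  also have "\<dots> = (\<integral>\<^sup>+ \<omega>. F (\<lambda>i. w i \<omega>) \<partial>M)"
    unfolding Xe by (simp add: fun_upd_idem Y_def)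
  finally show ?case using IH by (simp add: F'_def[abs_def])
qed

section \<open>Quadratic costs and the Riccati equation\<close>

declare transpose_matrix_vector [simp del]

lemma inner_transpose_matrix_vector:
  fixes M :: "real^'m^'n"
  shows "x \<bullet> (transpose M *v y) = (M *v x) \<bullet> y"
  by (simp add: inner_matrix_vector)

lemma norm_add_sq_le: "(norm (x + y))\<^sup>2 \<le> 2 * (norm x)\<^sup>2 + 2 * (norm y)\<^sup>2"
proof -
  have "(norm (x + y))\<^sup>2 \<le> (norm x + norm y)\<^sup>2" by (intro power_mono norm_triangle_ineq) auto
  also have "\<dots> \<le> 2 * (norm x)\<^sup>2 + 2 * (norm y)\<^sup>2"
    using zero_le_power2[of "norm x - norm y"] by (simp add: power2_eq_square algebra_simps)
  finally show ?thesis .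
qed

lemma matrix_vector_sq_bound:
  fixes M :: "real^'m^'n"
  obtains c where "c \<ge> 0" "\<And>x. (norm (M *v x))\<^sup>2 \<le> c * (norm x)\<^sup>2"
proof -
  obtain c where c: "c \<ge> 0" "\<And>x. norm (M *v x) \<le> c * norm x" using matrix_vector_norm_bound by blast
  have "(norm (M *v x))\<^sup>2 \<le> c\<^sup>2 * (norm x)\<^sup>2" for x
    using power_mono[OF c(2), of x 2] by (simp add: power_mult_distrib)
  thus ?thesis using that[of "c\<^sup>2"] by simp
qed

lemma quadratic_form_bound:
  fixes M :: "real^'n^'n"
  obtains c where "c \<ge> 0" "\<And>x. \<bar>x \<bullet> (M *v x)\<bar> \<le> c * (norm x)\<^sup>2"
proof -
  obtain c where c: "c \<ge> 0" "\<And>x. norm (M *v x) \<le> c * norm x" using matrix_vector_norm_bound by blast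
  have "\<bar>x \<bullet> (M *v x)\<bar> \<le> c * (norm x)\<^sup>2" for x
  proof -
    have "\<bar>x \<bullet> (M *v x)\<bar> \<le> norm x * norm (M *v x)" by (rule Cauchy_Schwarz_ineq2)
    also have "\<dots> \<le> norm x * (c * norm x)" using c by (intro mult_left_mono) auto
    finally show ?thesis by (simp add: power2_eq_square algebra_simps)
  qed
  thus ?thesis using that c by blast
qed

lemma matrix_combination_sq_bound:
  fixes G :: "nat \<Rightarrow> real^'m^'n"
  shows "\<exists>c\<ge>0. \<forall>v. (norm (\<Sum>i<k. G i *v v i))\<^sup>2 \<le> c * (\<Sum>i<k. (norm (v i))\<^sup>2)"
proof (induction k)
  case (Suc k)
  then obtain c where c: "c \<ge> 0" "\<And>v. (norm (\<Sum>i<k. G i *v v i))\<^sup>2 \<le> c * (\<Sum>i<k. (norm (v i))\<^sup>2)"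
    by blast
  obtain d where d: "d \<ge> 0" "\<And>x. (norm (G k *v x))\<^sup>2 \<le> d * (norm x)\<^sup>2"
    using matrix_vector_sq_bound by blast
  have "(norm (\<Sum>i<Suc k. G i *v v i))\<^sup>2 \<le> (2 * c + 2 * d) * (\<Sum>i<Suc k. (norm (v i))\<^sup>2)" for v
  proof -
    have "(norm (\<Sum>i<Suc k. G i *v v i))\<^sup>2 \<le> 2 * (norm (\<Sum>i<k. G i *v v i))\<^sup>2 + 2 * (norm (G k *v v k))\<^sup>2"
      by (simp add: norm_add_sq_le)
    also have "\<dots> \<le> 2 * (c * (\<Sum>i<k. (norm (v i))\<^sup>2)) + 2 * (d * (norm (v k))\<^sup>2)"
      using c(2)[of v] d(2)[of "v k"] by simp
    also have "\<dots> \<le> (2 * c + 2 * d) * (\<Sum>i<Suc k. (norm (v i))\<^sup>2)"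
    proof -
      have "0 \<le> 2 * c * (norm (v k))\<^sup>2 + 2 * d * (\<Sum>i<k. (norm (v i))\<^sup>2)"
        using c(1) d(1) by (intro add_nonneg_nonneg mult_nonneg_nonneg sum_nonneg) auto
      thus ?thesis by (simp add: algebra_simps)
    qed
    finally show ?thesis .
  qed
  thus ?case using c d by (intro exI[of _ "2 * c + 2 * d"]) auto
qed auto

text \<open>Nonnegativity of the form at z = r x - M x, with r a bound for the form, gives r (M x) .
  (M x) <= r^2 x . (M x) directly, without a square root of \<open>M\<close> or eigenvectors. Adding
  1 to q makes r positive for the division.\<close>

lemma pos_semidef_sq_bound:
  assumes "pos_semidef M"
  obtains c where "c \<ge> 0" "\<And>x. (norm (M *v x))\<^sup>2 \<le> c * (x \<bullet> (M *v x))"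
proof -
  obtain q where q: "q \<ge> 0" "\<And>x. \<bar>x \<bullet> (M *v x)\<bar> \<le> q * (norm x)\<^sup>2"
    using quadratic_form_bound by blast
  define r where "r = q + 1"
  have r: "r > 0" using q by (simp add: r_def)
  have sym: "transpose M = M" and psd: "\<And>x. 0 \<le> x \<bullet> (M *v x)"
    using assms by (auto simp: pos_semidef_def)
  have "(norm (M *v x))\<^sup>2 \<le> r * (x \<bullet> (M *v x))" for x
  proof -
    define y where "y = M *v x"
    define z where "z = r *\<^sub>R x - y"
    have xy: "x \<bullet> (M *v y) = y \<bullet> y"
      using inner_transpose_matrix_vector[of x M y] by (simp add: sym y_def)
    have "0 \<le> z \<bullet> (M *v z)" by (rule psd)
    also have "z \<bullet> (M *v z) = r\<^sup>2 * (x \<bullet> y) - 2 * r * (y \<bullet> y) + y \<bullet> (M *v y)"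
      using xy by (simp add: z_def y_def[symmetric] matrix_vector_mult_diff_distrib
          matrix_vector_mult_scaleR inner_diff_left inner_diff_right power2_eq_square algebra_simps
          inner_commute)
    also have "y \<bullet> (M *v y) \<le> r * (y \<bullet> y)"
    proof -
      have "y \<bullet> (M *v y) \<le> q * (y \<bullet> y)" using q(2)[of y] by (simp add: power2_norm_eq_inner)
      also have "\<dots> \<le> r * (y \<bullet> y)" by (intro mult_right_mono) (auto simp: r_def)
      finally show ?thesis .
    qed
    finally have "0 \<le> r * (r * (x \<bullet> y) - y \<bullet> y)" by (simp add: power2_eq_square algebra_simps)
    hence "y \<bullet> y \<le> r * (x \<bullet> y)" using r by (simp add: zero_le_mult_iff)
    thus ?thesis by (simp add: y_def power2_norm_eq_inner)
  qed
  thus ?thesis using that[of r] r by simp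
qed

lemma pos_def_imp_pos_semidef: "pos_def M \<Longrightarrow> pos_semidef M"
  unfolding pos_def_def pos_semidef_def by (metis inner_zero_left less_eq_real_def)

lemma pos_def_invertible:
  fixes M :: "real^'n^'n"
  assumes "pos_def M"
  shows "invertible M"
proof -
  have "\<forall>x. M *v x = 0 \<longrightarrow> x = 0"
    using assms unfolding pos_def_def by (metis inner_zero_right less_irrefl)
  thus ?thesis unfolding invertible_left_inverse matrix_left_invertible_ker .
qed

lemma matrix_inv_mult:
  assumes "invertible M"
  shows "M ** matrix_inv M = mat 1" "matrix_inv M ** M = mat 1"
  using someI_ex[OF assms[unfolded invertible_def]] unfolding matrix_inv_def by auto

text \<open>Coercivity follows by recovering x from M x with the inverse, which bounds x by M x and
  hence by the form.\<close>

lemma pos_def_norm_bound: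
  fixes M :: "real^'n^'n"
  assumes "pos_def M"
  obtains c where "c \<ge> 0" "\<And>x. (norm x)\<^sup>2 \<le> c * (x \<bullet> (M *v x))"
proof -
  obtain c where c: "c \<ge> 0" "\<And>x. (norm (M *v x))\<^sup>2 \<le> c * (x \<bullet> (M *v x))"
    using pos_semidef_sq_bound[OF pos_def_imp_pos_semidef[OF assms]] by blast
  obtain d where d: "d \<ge> 0" "\<And>x. (norm (matrix_inv M *v x))\<^sup>2 \<le> d * (norm x)\<^sup>2"
    using matrix_vector_sq_bound by blast
  have "(norm x)\<^sup>2 \<le> (d * c) * (x \<bullet> (M *v x))" for x
  proof -
    have "x = matrix_inv M *v (M *v x)"
      by (simp add: matrix_vector_mul_assoc matrix_inv_mult[OF pos_def_invertible[OF assms]])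
    hence "(norm x)\<^sup>2 \<le> d * (norm (M *v x))\<^sup>2" using d(2)[of "M *v x"] by simp
    also have "\<dots> \<le> d * (c * (x \<bullet> (M *v x)))" using d(1) c(2) by (intro mult_left_mono)
    finally show ?thesis by simp
  qed
  thus ?thesis using that[of "d * c"] c d by simp
qed

text \<open>Output injection: with L the transposed detectability gain, x evolves by the stable
  matrix A - L Q driven by L Q x + B u + w. The stage cost controls the first two summands, so
  \<open>stable_sum_bound\<close> applies pathwise, for every input sequence.\<close>

lemma detectable_state_bound:
  fixes A Q :: "real^'n^'n" and B :: "real^'d^'n"
  assumes "detectable A Q" "pos_semidef Q" "pos_def R"
  obtains C where "C \<ge> 0" "\<And>x0 u w T. (\<Sum>t<T. (norm (trajectory A B x0 u w t))\<^sup>2) \<le>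
    C * ((norm x0)\<^sup>2 + (\<Sum>t<T. trajectory A B x0 u w t \<bullet> (Q *v trajectory A B x0 u w t) + u t \<bullet> (R *v u t))
       + (\<Sum>t<T. (norm (w t))\<^sup>2))"
proof -
  obtain K where K: "spectral_radius (transpose A - Q ** K) < 1"
    using assms(1) by (auto simp: detectable_def stabilizable_def)
  define L where "L = transpose K"
  have sym: "transpose Q = Q" using assms by (simp add: pos_semidef_def)
  have tr: "transpose (transpose A - Q ** K) = A - L ** Q"
  proof -
    have "transpose (transpose A - Q ** K) = transpose (transpose A) - transpose (Q ** K)"
      by (simp add: transpose_def vec_eq_iff)
    thus ?thesis by (simp add: matrix_transpose_mul sym L_def)
  qed
  have "mat_pow (A - L ** Q) \<longlonglongrightarrow> 0"
    using mat_pow_transpose_tendsto_0[OF mat_pow_tendsto_0_if_spectral_radius[OF K]] unfolding tr .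
  then obtain N where "\<And>x. norm (mat_pow (A - L ** Q) N *v x) \<le> norm x / 2"
    using mat_pow_contracts by blast
  then obtain C where C: "C \<ge> 0" "\<And>x v T. (\<And>t. x (Suc t) = (A - L ** Q) *v x t + v t) \<Longrightarrow>
    (\<Sum>t<T. (norm (x t))\<^sup>2) \<le> C * ((norm (x 0))\<^sup>2 + (\<Sum>t<T. (norm (v t))\<^sup>2))"
    using stable_sum_bound[of "A - L ** Q" N] by metis
  obtain l where l: "l \<ge> 0" "\<And>x. (norm (L *v x))\<^sup>2 \<le> l * (norm x)\<^sup>2" using matrix_vector_sq_bound by blast
  obtain q where q: "q \<ge> 0" "\<And>x. (norm (Q *v x))\<^sup>2 \<le> q * (x \<bullet> (Q *v x))"
    using pos_semidef_sq_bound[OF assms(2)] by blast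
  obtain b where b: "b \<ge> 0" "\<And>x. (norm (B *v x))\<^sup>2 \<le> b * (norm x)\<^sup>2" using matrix_vector_sq_bound by blast
  obtain r where r: "r \<ge> 0" "\<And>x. (norm x)\<^sup>2 \<le> r * (x \<bullet> (R *v x))"
    using pos_def_norm_bound[OF assms(3)] by blast
  \<comment> \<open>Two uses of |a + b|^2 <= 2 |a|^2 + 2 |b|^2 give the factors 4, 4 and 2; d also
    exceeds 1, so it can absorb the initial state.\<close>
  define d where "d = 4 * l * q + 4 * b * r + 2"
  have d: "d \<ge> 2" using l q b r by (simp add: d_def)
  have Q0: "0 \<le> x \<bullet> (Q *v x)" for x using assms by (simp add: pos_semidef_def)
  have R0: "0 \<le> x \<bullet> (R *v x)" for x
    using pos_def_imp_pos_semidef[OF assms(3)] by (simp add: pos_semidef_def)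
  show ?thesis
  proof (rule that[of "C * d"])
    fix x0 u w T
    let ?x = "trajectory A B x0 u w"
    define v where "v t = L *v (Q *v ?x t) + B *v u t + w t" for t
    have rec: "?x (Suc t) = (A - L ** Q) *v ?x t + v t" for t
      by (simp add: v_def matrix_vector_mult_diff_rdistrib matrix_vector_mul_assoc)
    have v: "(norm (v t))\<^sup>2 \<le> d * (?x t \<bullet> (Q *v ?x t) + u t \<bullet> (R *v u t)) + d * (norm (w t))\<^sup>2" for t
    proof -
      have "(norm (v t))\<^sup>2 \<le> 2 * (norm (L *v (Q *v ?x t) + B *v u t))\<^sup>2 + 2 * (norm (w t))\<^sup>2"
        unfolding v_def by (rule norm_add_sq_le)
      also have "\<dots> \<le> 4 * (norm (L *v (Q *v ?x t)))\<^sup>2 + 4 * (norm (B *v u t))\<^sup>2 + 2 * (norm (w t))\<^sup>2"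
        using norm_add_sq_le[of "L *v (Q *v ?x t)" "B *v u t"] by simp
      also have "(norm (L *v (Q *v ?x t)))\<^sup>2 \<le> l * (q * (?x t \<bullet> (Q *v ?x t)))"
        using l(2)[of "Q *v ?x t"] mult_left_mono[OF q(2)[of "?x t"] l(1)] by linarith
      also have "(norm (B *v u t))\<^sup>2 \<le> b * (r * (u t \<bullet> (R *v u t)))"
        using b(2)[of "u t"] mult_left_mono[OF r(2)[of "u t"] b(1)] by linarith
      finally have 1: "(norm (v t))\<^sup>2 \<le> (4 * l * q) * (?x t \<bullet> (Q *v ?x t)) +
          (4 * b * r) * (u t \<bullet> (R *v u t)) + 2 * (norm (w t))\<^sup>2" by (simp add: algebra_simps)
      have "(4 * l * q) * (?x t \<bullet> (Q *v ?x t)) \<le> d * (?x t \<bullet> (Q *v ?x t))"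
        using l q b r Q0 by (intro mult_right_mono) (auto simp: d_def)
      moreover have "(4 * b * r) * (u t \<bullet> (R *v u t)) \<le> d * (u t \<bullet> (R *v u t))"
        using l q b r R0 by (intro mult_right_mono) (auto simp: d_def)
      moreover have "2 * (norm (w t))\<^sup>2 \<le> d * (norm (w t))\<^sup>2" using d by (intro mult_right_mono) auto
      ultimately show ?thesis using 1 by (simp add: distrib_left)
    qed
    have "(\<Sum>t<T. (norm (?x t))\<^sup>2) \<le> C * ((norm (?x 0))\<^sup>2 + (\<Sum>t<T. (norm (v t))\<^sup>2))"
      by (rule C(2)) (rule rec)
    also have "\<dots> \<le> C * (d * (norm x0)\<^sup>2 + (\<Sum>t<T. d * (?x t \<bullet> (Q *v ?x t) + u t \<bullet> (R *v u t)) + d * (norm (w t))\<^sup>2))"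
    proof (intro mult_left_mono add_mono sum_mono v C)
      show "(norm (?x 0))\<^sup>2 \<le> d * (norm x0)\<^sup>2" using mult_right_mono[of 1 d "(norm x0)\<^sup>2"] d by simp
    qed
    finally show "(\<Sum>t<T. (norm (?x t))\<^sup>2) \<le> C * d *
        ((norm x0)\<^sup>2 + (\<Sum>t<T. ?x t \<bullet> (Q *v ?x t) + u t \<bullet> (R *v u t)) + (\<Sum>t<T. (norm (w t))\<^sup>2))"
      by (simp add: sum.distrib sum_distrib_left distrib_left mult.assoc add.assoc)
  qed (use C d in auto)
qed

section \<open>Completing the square with the Riccati solution\<close>

locale lqr =
  fixes A Q P :: "real^'n^'n" and B :: "real^'d^'n" and R :: "real^'d^'d"
  assumes Q_psd: "pos_semidef Q" and R_pd: "pos_def R"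
    and detectable: "detectable A Q" and riccati: "riccati_solution A B Q R P"
begin

definition S :: "real^'d^'d" where "S = R + transpose B ** P ** B"
definition H :: "real^'n^'n" where "H = B ** matrix_inv S ** transpose B"
definition F :: "real^'n^'n" where "F = A - H ** P ** A"

definition stage :: "real^'n \<Rightarrow> real^'d \<Rightarrow> real" where
  "stage x u = x \<bullet> (Q *v x) + u \<bullet> (R *v u)"

definition input_error :: "real^'n \<Rightarrow> real^'d \<Rightarrow> real^'n \<Rightarrow> real^'d" where
  "input_error x u y = u + matrix_inv S *v (transpose B *v (P *v (A *v x) + y))"

lemma stage_nonneg: "0 \<le> stage x u"
  using Q_psd pos_def_imp_pos_semidef[OF R_pd] by (simp add: stage_def pos_semidef_def)

lemma transpose_P: "transpose P = P" and P_nonneg: "0 \<le> x \<bullet> (P *v x)"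
  using riccati by (auto simp: riccati_solution_def pos_semidef_def)

lemma S_form: "u \<bullet> (S *v u) = u \<bullet> (R *v u) + (B *v u) \<bullet> (P *v (B *v u))"
  by (simp add: S_def matrix_vector_mult_add_rdistrib inner_add_right inner_transpose_matrix_vector
      flip: matrix_vector_mul_assoc)

lemma transpose_S: "transpose S = S"
proof -
  have "transpose R = R" using R_pd by (simp add: pos_def_def)
  moreover have "transpose (X + Y) = transpose X + transpose Y" for X Y :: "real^'d^'d"
    by (simp add: transpose_def vec_eq_iff)
  ultimately show ?thesis
    by (simp add: S_def matrix_transpose_mul transpose_P matrix_mul_assoc)
qed

lemma pos_def_S: "pos_def S"
  unfolding pos_def_def
proof (intro conjI transpose_S allI impI)
  fix u :: "real^'d" assume "u \<noteq> 0"
  hence "0 < u \<bullet> (R *v u)" using R_pd by (simp add: pos_def_def)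
  thus "0 < u \<bullet> (S *v u)" using S_form[of u] P_nonneg[of "B *v u"] by linarith
qed

lemma S_inv_cancel: "S *v (matrix_inv S *v u) = u" "matrix_inv S *v (S *v u) = u"
  using matrix_inv_mult[OF pos_def_invertible[OF pos_def_S]]
  by (simp_all add: matrix_vector_mul_assoc)

lemma transpose_S_inv: "transpose (matrix_inv S) = matrix_inv S"
proof -
  note inv = matrix_inv_mult[OF pos_def_invertible[OF pos_def_S]]
  have "transpose (matrix_inv S) ** S = mat 1"
    using arg_cong[OF inv(1), of transpose] by (simp add: matrix_transpose_mul transpose_S)
  hence "transpose (matrix_inv S) ** S ** matrix_inv S = matrix_inv S" by simp
  thus ?thesis by (simp add: inv flip: matrix_mul_assoc)
qed

lemma transpose_H: "transpose H = H"
  by (simp add: H_def matrix_transpose_mul transpose_S_inv matrix_mul_assoc)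

lemma transpose_F: "transpose F = transpose A - transpose A ** P ** H"
proof -
  have "transpose (X - Y) = transpose X - transpose Y" for X Y :: "real^'n^'n"
    by (simp add: transpose_def vec_eq_iff)
  thus ?thesis by (simp add: F_def matrix_transpose_mul transpose_P transpose_H matrix_mul_assoc)
qed

lemma H_apply: "H *v y = B *v (matrix_inv S *v (transpose B *v y))"
  by (simp add: H_def flip: matrix_vector_mul_assoc)

lemma F_apply: "F *v x = A *v x - B *v (matrix_inv S *v (transpose B *v (P *v (A *v x))))"
  by (simp add: F_def matrix_vector_mult_diff_rdistrib H_apply flip: matrix_vector_mul_assoc)

lemma inner_S_commute: "a \<bullet> (S *v b) = b \<bullet> (S *v a)"
  by (metis inner_commute inner_transpose_matrix_vector transpose_S)

lemma inner_P_commute: "a \<bullet> (P *v b) = b \<bullet> (P *v a)"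
  by (metis inner_commute inner_transpose_matrix_vector transpose_P)

lemma riccati_form:
  fixes x :: "real^'n"
  defines "p \<equiv> transpose B *v (P *v (A *v x))"
  shows "x \<bullet> (P *v x) = x \<bullet> (Q *v x) + (A *v x) \<bullet> (P *v (A *v x)) - p \<bullet> (matrix_inv S *v p)"
proof -
  have P: "P = Q + transpose A ** P ** A - transpose A ** P ** B ** matrix_inv S ** transpose B ** P ** A"
    using riccati by (simp add: riccati_solution_def S_def)
  have "P *v x = Q *v x + transpose A *v (P *v (A *v x)) - transpose A *v (P *v (B *v (matrix_inv S *v p)))"
    by (subst P) (simp add: p_def matrix_vector_mult_diff_rdistrib matrix_vector_mult_add_rdistrib
        flip: matrix_vector_mul_assoc)
  moreover have "(A *v x) \<bullet> (P *v (B *v (matrix_inv S *v p))) = p \<bullet> (matrix_inv S *v p)"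
    by (metis inner_P_commute inner_commute inner_matrix_vector p_def)
  ultimately show ?thesis
    by (simp add: inner_diff_right inner_add_right inner_transpose_matrix_vector)
qed

text \<open>Here \<open>y\<close> and \<open>y'\<close> are the prediction terms of two consecutive steps and \<open>d\<close> is the part that is
  revealed in between.\<close>

lemma one_step:
  fixes x v y y' d :: "real^'n" and u :: "real^'d"
  assumes y: "P *v v + transpose F *v y' = y + d"
  defines "x' \<equiv> A *v x + B *v u + v"
  shows "stage x u + x' \<bullet> (P *v x') + 2 * (x' \<bullet> (transpose F *v y')) =
    x \<bullet> (P *v x) + 2 * (x \<bullet> (transpose F *v y)) +
    input_error x u y \<bullet> (S *v input_error x u y) - y \<bullet> (H *v y) +
    v \<bullet> (P *v v) + 2 * (v \<bullet> (transpose F *v y')) + 2 * ((A *v x + B *v u) \<bullet> d)"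
proof -
  define s where "s = A *v x + B *v u"
  define p where "p = transpose B *v (P *v (A *v x))"
  define a where "a = u + matrix_inv S *v p"
  define b where "b = transpose B *v y"
  have x': "x' = s + v" by (simp add: x'_def s_def)
  have e: "input_error x u y = a + matrix_inv S *v b"
    by (simp add: input_error_def a_def p_def b_def matrix_vector_right_distrib)
  have "input_error x u y \<bullet> (S *v input_error x u y) = a \<bullet> (S *v a) + 2 * (a \<bullet> b) + b \<bullet> (matrix_inv S *v b)"
    using inner_S_commute[of "matrix_inv S *v b" a]
    by (simp add: e matrix_vector_right_distrib inner_add_left inner_add_right S_inv_cancel inner_commute)
  moreover have "y \<bullet> (H *v y) = b \<bullet> (matrix_inv S *v b)"
    unfolding H_apply b_def by (metis inner_commute inner_matrix_vector)
  moreover have "a \<bullet> (S *v a) = u \<bullet> (S *v u) + 2 * (u \<bullet> p) + p \<bullet> (matrix_inv S *v p)"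
    using inner_S_commute[of "matrix_inv S *v p" u]
    by (simp add: a_def matrix_vector_right_distrib inner_add_left inner_add_right S_inv_cancel inner_commute)
  moreover have "s \<bullet> (P *v s) = (A *v x) \<bullet> (P *v (A *v x)) + 2 * (u \<bullet> p) + (B *v u) \<bullet> (P *v (B *v u))"
    using inner_P_commute[of "A *v x" "B *v u"]
    by (simp add: s_def p_def matrix_vector_right_distrib inner_add_left inner_add_right
        inner_transpose_matrix_vector)
  moreover have "x' \<bullet> (P *v x') = s \<bullet> (P *v s) + 2 * (s \<bullet> (P *v v)) + v \<bullet> (P *v v)"
    using inner_P_commute[of v s]
    by (simp add: x' matrix_vector_right_distrib inner_add_left inner_add_right)
  moreover have "x' \<bullet> (transpose F *v y') = s \<bullet> (transpose F *v y') + v \<bullet> (transpose F *v y')"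
    by (simp add: x' inner_add_left)
  moreover have "s \<bullet> (P *v v) + s \<bullet> (transpose F *v y') = s \<bullet> y + s \<bullet> d"
    using y by (simp flip: inner_add_right)
  \<comment> \<open>This is s = F x + B a: deviating by \<open>a\<close> from the Riccati feedback
    perturbs the closed loop by B a. It is the reason for the cross term with F^T y in the
    potential.\<close>
  moreover have "s \<bullet> y = x \<bullet> (transpose F *v y) + a \<bullet> b"
    by (simp add: s_def a_def b_def p_def inner_transpose_matrix_vector F_apply inner_add_left
        inner_diff_left matrix_vector_right_distrib)
  ultimately show ?thesis
    using riccati_form[of x] S_form[of u]
    by (simp add: stage_def p_def[symmetric] s_def[symmetric])
qed

text \<open>Without noise the Riccati feedback has total cost at most x0 . P x0, so detectability
  makes the orbits of \<open>F\<close> square summable.\<close>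

lemma F_contracts: "\<exists>N. \<forall>x. norm (mat_pow F N *v x) \<le> norm x / 2"
proof -
  obtain C where C: "C \<ge> 0" "\<And>x0 (u :: nat \<Rightarrow> real^'d) w T. (\<Sum>t<T. (norm (trajectory A B x0 u w t))\<^sup>2) \<le>
    C * ((norm x0)\<^sup>2 + (\<Sum>t<T. trajectory A B x0 u w t \<bullet> (Q *v trajectory A B x0 u w t) + u t \<bullet> (R *v u t))
       + (\<Sum>t<T. (norm (w t))\<^sup>2))"
    using detectable_state_bound[OF detectable Q_psd R_pd, of B] by blast
  obtain p where p: "p \<ge> 0" "\<And>x. \<bar>x \<bullet> (P *v x)\<bar> \<le> p * (norm x)\<^sup>2" using quadratic_form_bound by blast
  show ?thesis
  proof (rule square_summable_contracts)
    fix x0 T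
    define u where "u t = - (matrix_inv S *v (transpose B *v (P *v (A *v (mat_pow F t *v x0)))))" for t
    have tr: "trajectory A B x0 u (\<lambda>_. 0) t = mat_pow F t *v x0" for t
    proof (induction t)
      case (Suc t)
      thus ?case by (simp add: u_def F_apply flip: matrix_vector_mul_assoc)
          (metis (no_types) add.inverse_inverse diff_conv_add_uminus vec.neg)
    qed simp
    have "(\<Sum>t<T. stage (mat_pow F t *v x0) (u t)) + (mat_pow F T *v x0) \<bullet> (P *v (mat_pow F T *v x0)) =
        x0 \<bullet> (P *v x0)"
    proof (induction T)
      case (Suc T)
      let ?x = "mat_pow F T *v x0"
      have e: "input_error ?x (u T) 0 = 0" by (simp add: input_error_def u_def)
      have x': "A *v ?x + B *v u T + 0 = mat_pow F (Suc T) *v x0"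
        using tr[of "Suc T"] tr[of T] by simp
      \<comment> \<open>With noise and predictions zero, the identity says that x . P x decreases by
        exactly the stage cost.\<close>
      from one_step[of 0 0 0 0 ?x "u T", unfolded x' e]
      show ?case using Suc by simp
    qed simp
    hence "(\<Sum>t<T. stage (mat_pow F t *v x0) (u t)) \<le> p * (norm x0)\<^sup>2"
      using p(2)[of x0] P_nonneg[of "mat_pow F T *v x0"] by linarith
    hence "C * ((norm x0)\<^sup>2 + (\<Sum>t<T. stage (mat_pow F t *v x0) (u t))) \<le> C * ((norm x0)\<^sup>2 + p * (norm x0)\<^sup>2)"
      using C(1) by (intro mult_left_mono) auto
    moreover have "(\<Sum>t<T. (norm (mat_pow F t *v x0))\<^sup>2) \<le> C * ((norm x0)\<^sup>2 + (\<Sum>t<T. stage (mat_pow F t *v x0) (u t)))"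
      using C(2)[where ?x0.0 = x0 and u = u and w = "\<lambda>_. 0" and T = T] by (simp add: tr stage_def)
    ultimately show "(\<Sum>t<T. (norm (mat_pow F t *v x0))\<^sup>2) \<le> (C * (1 + p)) * (norm x0)\<^sup>2"
      by (simp add: algebra_simps)
  qed
qed

section \<open>Prediction terms and the telescoped cost\<close>

definition forecast :: "nat \<Rightarrow> (nat \<Rightarrow> real^'n) \<Rightarrow> nat \<Rightarrow> real^'n" where
  "forecast k w t = (\<Sum>i<k. mat_pow (transpose F) i *v (P *v w (t + i)))"

definition potential :: "nat \<Rightarrow> (nat \<Rightarrow> real^'n) \<Rightarrow> nat \<Rightarrow> real^'n \<Rightarrow> real" where
  "potential k w t x = x \<bullet> (P *v x) + 2 * (x \<bullet> (transpose F *v forecast k w t))"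

text \<open>Collects the summands of \<open>one_step\<close> that involve neither state nor
  input.\<close>

definition noise_cost :: "nat \<Rightarrow> (nat \<Rightarrow> real^'n) \<Rightarrow> nat \<Rightarrow> real" where
  "noise_cost k w t = w t \<bullet> (P *v w t) + 2 * (w t \<bullet> (transpose F *v forecast k w (Suc t)))
     - forecast k w t \<bullet> (H *v forecast k w t)"

definition innovation_cost ::
  "nat \<Rightarrow> real^'n \<Rightarrow> (nat \<Rightarrow> real^'d) \<Rightarrow> (nat \<Rightarrow> real^'n) \<Rightarrow> nat \<Rightarrow> real" where
  "innovation_cost k x0 u w t = 2 * ((A *v trajectory A B x0 u w t + B *v u t) \<bullet>
     (mat_pow (transpose F) k *v (P *v w (t + k))))"

text \<open>Both sides are the forecast sum at t with k + 1 terms. This supplies the hypothesis of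
  \<open>one_step\<close>, with the newly revealed last term as d.\<close>

lemma forecast_Suc:
  "P *v w t + transpose F *v forecast k w (Suc t) =
     forecast k w t + mat_pow (transpose F) k *v (P *v w (t + k))"
proof -
  have "P *v w t + transpose F *v forecast k w (Suc t) =
    (\<Sum>i<Suc k. mat_pow (transpose F) i *v (P *v w (t + i)))"
    by (subst sum.lessThan_Suc_shift)
       (simp add: forecast_def linear_sum[OF matrix_vector_mul_linear] flip: matrix_vector_mul_assoc)
  thus ?thesis by (simp add: forecast_def)
qed

lemma stage_sum:
  fixes x0 u w
  defines "x \<equiv> trajectory A B x0 u w"
  shows "(\<Sum>t<T. stage (x t) (u t)) + potential k w T (x T) = potential k w 0 x0 +
    (\<Sum>t<T. input_error (x t) (u t) (forecast k w t) \<bullet> (S *v input_error (x t) (u t) (forecast k w t))) +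
    (\<Sum>t<T. noise_cost k w t + innovation_cost k x0 u w t)"
proof (induction T)
  case (Suc T)
  have "x (Suc T) = A *v x T + B *v u T + w T" by (simp add: x_def)
  with Suc one_step[OF forecast_Suc[of w T k], of "x T" "u T"] show ?case
    by (simp add: potential_def noise_cost_def innovation_cost_def x_def[symmetric])
qed (simp add: x_def)

lemma potential_bound:
  "\<exists>c\<ge>0. \<forall>w t x. \<bar>potential k w t x\<bar> \<le> c * ((norm x)\<^sup>2 + (\<Sum>i<k. (norm (w (t + i)))\<^sup>2))"
proof -
  obtain p where p: "p \<ge> 0" "\<And>x. \<bar>x \<bullet> (P *v x)\<bar> \<le> p * (norm x)\<^sup>2" using quadratic_form_bound by blast
  obtain c where c: "c \<ge> 0" "\<And>v. (norm (\<Sum>i<k. (mat_pow (transpose F) (Suc i) ** P) *v v i))\<^sup>2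
       \<le> c * (\<Sum>i<k. (norm (v i))\<^sup>2)"
    using matrix_combination_sq_bound[of "\<lambda>i. mat_pow (transpose F) (Suc i) ** P" k] by blast
  have "\<bar>potential k w t x\<bar> \<le> (p + 1 + c) * ((norm x)\<^sup>2 + (\<Sum>i<k. (norm (w (t + i)))\<^sup>2))" for w t x
  proof -
    define y where "y = transpose F *v forecast k w t"
    have "y = (\<Sum>i<k. (mat_pow (transpose F) (Suc i) ** P) *v w (t + i))"
      by (simp add: y_def forecast_def linear_sum[OF matrix_vector_mul_linear]
          flip: matrix_vector_mul_assoc)
    hence y: "(norm y)\<^sup>2 \<le> c * (\<Sum>i<k. (norm (w (t + i)))\<^sup>2)" using c(2)[of "\<lambda>i. w (t + i)"] by simp
    have "\<bar>2 * (x \<bullet> y)\<bar> \<le> 2 * (norm x * norm y)" using Cauchy_Schwarz_ineq2[of x y] by simp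
    also have "\<dots> \<le> (norm x)\<^sup>2 + (norm y)\<^sup>2"
      using zero_le_power2[of "norm x - norm y"] by (simp add: power2_eq_square algebra_simps)
    finally have "\<bar>potential k w t x\<bar> \<le> (p + 1) * (norm x)\<^sup>2 + c * (\<Sum>i<k. (norm (w (t + i)))\<^sup>2)"
      using p(2)[of x] y unfolding potential_def y_def[symmetric] by (simp add: distrib_right)
    moreover have "0 \<le> c * (norm x)\<^sup>2 + (p + 1) * (\<Sum>i<k. (norm (w (t + i)))\<^sup>2)"
      using c p by (intro add_nonneg_nonneg mult_nonneg_nonneg sum_nonneg) auto
    ultimately show ?thesis by (simp add: algebra_simps)
  qed
  thus ?thesis using c p by (intro exI[of _ "p + 1 + c"]) auto
qed

lemma transpose_F_pow_form:
  "v \<bullet> ((P ** mat_pow F i ** H ** mat_pow (transpose F) i ** P) *v v) =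
   (mat_pow (transpose F) i *v (P *v v)) \<bullet> (H *v (mat_pow (transpose F) i *v (P *v v)))"
  by (simp add: inner_matrix_vector transpose_mat_pow transpose_P flip: matrix_vector_mul_assoc)

text \<open>Each cross term is attached to the later of its two noises: the coefficient of
  \<open>w (t + j)\<close> contains only \<open>forecast j\<close>, which reads earlier noise. In
  this form the cross terms have causal mean zero and only the diagonal contributes.\<close>

lemma forecast_form:
  "forecast k w t \<bullet> (H *v forecast k w t) =
    (\<Sum>j<k. w (t + j) \<bullet> ((P ** mat_pow F j ** H ** mat_pow (transpose F) j ** P) *v w (t + j))) +
    (\<Sum>j<k. (2 *\<^sub>R (P *v (mat_pow F j *v (H *v forecast j w t)))) \<bullet> w (t + j))"
proof (induction k)
  case (Suc k)
  define q where "q = mat_pow (transpose F) k *v (P *v w (t + k))"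
  have f: "forecast (Suc k) w t = forecast k w t + q" by (simp add: forecast_def q_def)
  have "(P *v (mat_pow F k *v (H *v forecast k w t))) \<bullet> w (t + k) = forecast k w t \<bullet> (H *v q)"
    unfolding q_def by (simp add: inner_matrix_vector transpose_mat_pow transpose_P transpose_H)
  moreover have "forecast k w t \<bullet> (H *v q) = q \<bullet> (H *v forecast k w t)"
    by (metis inner_commute inner_matrix_vector transpose_H)
  moreover have "w (t + k) \<bullet> ((P ** mat_pow F k ** H ** mat_pow (transpose F) k ** P) *v w (t + k)) = q \<bullet> (H *v q)"
    unfolding transpose_F_pow_form q_def ..
  ultimately show ?case unfolding f using Suc
    by (simp add: matrix_vector_right_distrib inner_add_left inner_add_right)
qed (simp add: forecast_def)

end

section \<open>The average cost\<close>

lemma trace_mult_sub: "trace ((X - Y) ** W) = trace (X ** W) - trace (Y ** W)"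
  for X Y W :: "real^'n^'n"
  by (simp add: trace_def matrix_matrix_mult_def sum_subtractf left_diff_distrib)

lemma trace_mult_sum: "trace ((\<Sum>i\<in>I. X i) ** W) = (\<Sum>i\<in>I. trace (X i ** W))"
  for W :: "real^'n^'n"
proof (induction I rule: infinite_finite_induct)
  case (insert i I)
  have "trace ((X + Y) ** W) = trace (X ** W) + trace (Y ** W)" for X Y :: "real^'n^'n"
    by (simp add: trace_def matrix_matrix_mult_def sum.distrib distrib_right)
  with insert show ?case by simp
qed (simp_all add: trace_def matrix_matrix_mult_def)

lemma trajectory_cong:
  assumes "\<And>i. i < t \<Longrightarrow> u i = u' i" "\<And>i. i < t \<Longrightarrow> w i = w' i"
  shows "trajectory A B x0 u w t = trajectory A B x0 u' w' t"
  using assms by (induction t) auto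

lemma lqr_cost_noise_cong:
  assumes "\<And>i. i < T \<Longrightarrow> w i = w' i"
  shows "lqr_cost A B Q R Qf x0 T u w = lqr_cost A B Q R Qf x0 T u w'"
proof -
  have "trajectory A B x0 u w t = trajectory A B x0 u w' t" if "t \<le> T" for t
    using that assms by (intro trajectory_cong) auto
  thus ?thesis unfolding lqr_cost_def Let_def by (intro arg_cong2[of _ _ _ _ "(+)"] sum.cong) auto
qed

lemma borel_measurable_matrix_vector [measurable (raw)]:
  fixes M :: "real^'m^'n"
  assumes "f \<in> borel_measurable N"
  shows "(\<lambda>x. M *v f x) \<in> borel_measurable N"
  by (rule measurable_compose[OF assms borel_measurable_continuous_onI])
     (intro linear_continuous_on matrix_vector_mul_bounded_linear)

lemma square_integrable_imp_integrable_vector: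
  fixes f :: "'a \<Rightarrow> 'b::{banach,second_countable_topology}"
  assumes "prob_space N" and f: "f \<in> borel_measurable N" "integrable N (\<lambda>x. (norm (f x))\<^sup>2)"
  shows "integrable N f"
proof -
  interpret prob_space N by fact
  have "integrable N (\<lambda>x. 1 + (norm (f x))\<^sup>2)" using f(2) by simp
  thus ?thesis
  proof (rule Bochner_Integration.integrable_bound[OF _ f(1)], intro AE_I2)
    fix x
    have "norm (f x) \<le> 1 + (norm (f x))\<^sup>2"
      using sum_power2_ge_zero[of "norm (f x) - 1" "norm (f x)"] by (simp add: power2_diff)
    thus "norm (f x) \<le> norm (1 + (norm (f x))\<^sup>2)" by simp
  qed
qed

text \<open>Nested expectations integrate one law at a time, so the noise is represented by its laws
  \<open>D n\<close> and their moments. As the mean is zero, the covariance is stated as raw second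
  moments.\<close>

locale lqr_noise = lqr A Q P B R
  for A Q P :: "real^'n^'n" and B :: "real^'d^'n" and R :: "real^'d^'d" +
  fixes D :: "nat \<Rightarrow> (real^'n) measure" and W :: "real^'n^'n"
  assumes prob: "\<And>n. prob_space (D n)" and sets_D [measurable_cong]: "\<And>n. sets (D n) = sets borel"
    and integrable_sq: "\<And>n. integrable (D n) (\<lambda>z. (norm z)\<^sup>2)"
    and mean: "\<And>n. (\<integral>z. z \<partial>D n) = 0"
    and covariance: "\<And>n i j. (\<integral>z. z $ i * z $ j \<partial>D n) = W $ i $ j"
begin

lemma integrable_id: "integrable (D n) (\<lambda>z. z)"
  by (rule square_integrable_imp_integrable_vector[OF prob _ integrable_sq]) simp

lemma integrable_product: "integrable (D n) (\<lambda>z. z $ i * z $ j)"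
proof -
  have "norm (z $ i * z $ j) \<le> norm ((norm z)\<^sup>2)" for z :: "real^'n"
    using mult_mono[OF component_le_norm_cart[of z i] component_le_norm_cart[of z j]]
    by (simp add: abs_mult power2_eq_square)
  moreover have "(\<lambda>z. z $ i * z $ j) \<in> borel_measurable (D n)" by measurable
  ultimately show ?thesis
    by (intro Bochner_Integration.integrable_bound[OF integrable_sq]) auto
qed

lemma causal_term_quadratic:
  "causal_term k D n (\<lambda>u w. w n \<bullet> (G *v w n)) (trace (G ** W))"
proof -
  have W: "W $ j $ i = W $ i $ j" for i j
    using covariance[of n i j] covariance[of n j i] by (simp add: mult.commute)
  have eq: "z \<bullet> (G *v z) = (\<Sum>i\<in>UNIV. \<Sum>j\<in>UNIV. G $ i $ j * (z $ i * z $ j))" for z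
    by (simp add: inner_vec_def matrix_vector_mult_def sum_distrib_left algebra_simps)
  have "integrable (D n) (\<lambda>z. z \<bullet> (G *v z))"
    unfolding eq using integrable_product by auto
  moreover have "(\<integral>z. z \<bullet> (G *v z) \<partial>D n) = trace (G ** W)"
    unfolding eq using integrable_product
    by (simp add: Bochner_Integration.integral_sum covariance trace_def matrix_matrix_mult_def W)
  ultimately show ?thesis by (simp add: causal_term_def)
qed

text \<open>The strict bound i < n makes \<open>b\<close> constant while \<open>w n\<close> is
  integrated, and \<open>w n\<close> has mean zero.\<close>

lemma causal_term_linear:
  assumes "\<And>u u' w w'. (\<And>i. i + k \<le> n \<Longrightarrow> u i = u' i) \<Longrightarrow> (\<And>i. i < n \<Longrightarrow> w i = w' i) \<Longrightarrow> b u w = b u' w'"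
  shows "causal_term k D n (\<lambda>u w. b u w \<bullet> w n) 0"
proof -
  have b: "b u (w(n := z)) = b u w" for u w z by (rule assms) auto
  have "b u w \<bullet> w n = b u' w' \<bullet> w' n"
    if "\<forall>i. i + k \<le> n \<longrightarrow> u i = u' i" "\<forall>i\<le>n. w i = w' i" for u u' w w'
    using assms[of u u' w w'] that by auto
  moreover have "integrable (D n) (\<lambda>z. b u w \<bullet> z)" "(\<integral>z. b u w \<bullet> z \<partial>D n) = 0" for u w
    using integrable_id mean by auto
  ultimately show ?thesis unfolding causal_term_def by (simp add: b)
qed

lemma causal_sum_norm_sq:
  assumes "n < T"
  shows "causal_sum k D T (\<lambda>u w. (norm (w n))\<^sup>2) (trace W)"
  using causal_sum_term[OF causal_term_quadratic[of k n "mat 1"] assms]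
  by (simp add: power2_norm_eq_inner)

lemma trace_W_nonneg: "0 \<le> trace W"
  using covariance[of 0] by (auto simp: trace_def simp flip: covariance[of 0] intro!: sum_nonneg)

lemma inner_forecast:
  "x \<bullet> (transpose F *v forecast k w t) = (\<Sum>i<k. (P *v (mat_pow F i *v (F *v x))) \<bullet> w (t + i))"
  by (simp add: forecast_def inner_transpose_matrix_vector inner_sum_right
      transpose_mat_pow[of F, symmetric] inner_transpose_matrix_vector)
     (simp add: inner_matrix_vector transpose_P)

definition avg_cost :: "nat \<Rightarrow> real" where
  "avg_cost k = trace ((P - (\<Sum>i<k. P ** mat_pow F i ** H ** mat_pow (transpose F) i ** P)) ** W)"

text \<open>Only squares of a single noise have nonzero mean: one with matrix \<open>P\<close> from
  \<open>w t\<close>, and the diagonal of the forecast form. The bound on t is needed because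
  \<open>forecast k w (Suc t)\<close> reads up to \<open>w (t + k)\<close>.\<close>

lemma causal_sum_noise_cost:
  assumes "t + k < T"
  shows "causal_sum l D T (\<lambda>u w. noise_cost k w t) (avg_cost k)"
proof -
  let ?G = "\<lambda>i. P ** mat_pow F i ** H ** mat_pow (transpose F) i ** P"
  have 1: "causal_sum l D T (\<lambda>u w. w t \<bullet> (P *v w t)) (trace (P ** W))"
    using assms by (intro causal_sum_term[OF causal_term_quadratic]) auto
  have 2: "causal_sum l D T (\<lambda>u w. \<Sum>i<k. (P *v (mat_pow F i *v (F *v w t))) \<bullet> w (Suc t + i)) (\<Sum>i<k. 0)"
    using assms by (intro causal_sum_sum causal_sum_term[OF causal_term_linear]) auto
  have 3: "causal_sum l D T (\<lambda>u w. \<Sum>j<k. w (t + j) \<bullet> (?G j *v w (t + j))) (\<Sum>j<k. trace (?G j ** W))"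
    using assms by (intro causal_sum_sum causal_sum_term[OF causal_term_quadratic]) auto
  have 4: "causal_sum l D T (\<lambda>u w. \<Sum>j<k. (2 *\<^sub>R (P *v (mat_pow F j *v (H *v forecast j w t)))) \<bullet> w (t + j)) (\<Sum>j<k. 0)"
    using assms
    by (intro causal_sum_sum causal_sum_term[OF causal_term_linear]) (auto simp: forecast_def)
  show ?thesis
    using causal_sum_diff[OF causal_sum_add[OF 1 causal_sum_scale[OF 2, of 2]] causal_sum_add[OF 3 4]]
    by (simp add: noise_cost_def inner_forecast forecast_form avg_cost_def trace_mult_sub trace_mult_sum)
qed

text \<open>Here the information constraint enters: state and input at t depend on inputs i <= t,
  that is i + k <= t + k, and on noise before t, so all are fixed before \<open>w (t + k)\<close> is
  drawn.\<close>

lemma causal_sum_innovation_cost: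
  assumes "t + k < T"
  shows "causal_sum k D T (\<lambda>u w. innovation_cost k x0 u w t) 0"
proof -
  have eq: "innovation_cost k x0 u w t =
    2 * ((P *v (mat_pow F k *v (A *v trajectory A B x0 u w t + B *v u t))) \<bullet> w (t + k))" for u w
    by (simp add: innovation_cost_def transpose_mat_pow[of F, symmetric] inner_transpose_matrix_vector)
       (simp add: inner_matrix_vector transpose_P)
  have "causal_sum k D T (\<lambda>u w. (P *v (mat_pow F k *v (A *v trajectory A B x0 u w t + B *v u t))) \<bullet> w (t + k)) 0"
  proof (intro causal_sum_term[OF causal_term_linear] assms)
    fix u u' :: "nat \<Rightarrow> real^'d" and w w' :: "nat \<Rightarrow> real^'n"
    assume *: "\<And>i. i + k \<le> t + k \<Longrightarrow> u i = u' i" "\<And>i. i < t + k \<Longrightarrow> w i = w' i"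
    hence "trajectory A B x0 u w t = trajectory A B x0 u' w' t" by (intro trajectory_cong) auto
    moreover have "u t = u' t" using * by simp
    ultimately show "P *v (mat_pow F k *v (A *v trajectory A B x0 u w t + B *v u t)) =
      P *v (mat_pow F k *v (A *v trajectory A B x0 u' w' t + B *v u' t))" by simp
  qed
  from causal_sum_scale[OF this, of 2] show ?thesis by (simp add: eq)
qed

lemma causal_sum_potential:
  assumes "k \<le> T"
  shows "causal_sum l D T (\<lambda>u w. potential k w 0 x0) (x0 \<bullet> (P *v x0))"
proof -
  have "causal_sum l D T (\<lambda>u w. \<Sum>i<k. (P *v (mat_pow F i *v (F *v x0))) \<bullet> w i) (\<Sum>i<k. 0)"
    using assms by (intro causal_sum_sum causal_sum_term[OF causal_term_linear]) auto
  from causal_sum_add[OF causal_sum_const[of l D T "x0 \<bullet> (P *v x0)"] causal_sum_scale[OF this, of 2]]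
  show ?thesis by (simp add: potential_def inner_forecast)
qed

text \<open>Bounding the cost below by its value up to a time \<open>\<tau>\<close> leaves an error of order
  \<open>(norm (x \<tau>))\<^sup>2\<close>. By detectability the sum of these errors over \<open>\<tau>\<close> is bounded by the cost itself,
  so averaging over \<open>N\<close> consecutive times \<open>\<tau>\<close> makes them negligible.\<close>

lemma STO_horizon_lower:
  assumes Qf: "pos_semidef Qf"
  shows "\<exists>C\<ge>0. \<forall>N\<ge>1. \<exists>\<beta>. \<forall>T\<ge>N+k.
    ennreal (((real N * avg_cost k - C * trace W) * real T - \<beta>) / (real N + C))
      \<le> STO_horizon A B Q R Qf x0 D k T"
proof -
  obtain C1 where C1: "C1 \<ge> 0" "\<And>w t x. \<bar>potential k w t x\<bar> \<le> C1 * ((norm x)\<^sup>2 + (\<Sum>i<k. (norm (w (t + i)))\<^sup>2))"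
    using potential_bound by blast
  obtain C2 where C2: "C2 \<ge> 0" "\<And>x0 (u :: nat \<Rightarrow> real^'d) w T. (\<Sum>t<T. (norm (trajectory A B x0 u w t))\<^sup>2) \<le>
    C2 * ((norm x0)\<^sup>2 + (\<Sum>t<T. trajectory A B x0 u w t \<bullet> (Q *v trajectory A B x0 u w t) + u t \<bullet> (R *v u t))
       + (\<Sum>t<T. (norm (w t))\<^sup>2))"
    using detectable_state_bound[OF detectable Q_psd R_pd, of B] by blast
  define C where "C = C1 * C2"
  have C: "C \<ge> 0" using C1 C2 by (simp add: C_def)
  have S0: "0 \<le> u \<bullet> (S *v u)" for u
    using pos_def_imp_pos_semidef[OF pos_def_S] by (simp add: pos_semidef_def)
  show ?thesis
  proof (rule exI[of _ C], intro conjI C allI impI)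
    fix N :: nat assume N: "N \<ge> 1"
    define c where "c = avg_cost k"
    \<comment> \<open>Everything independent of T. The summand with the absolute value of c pays for
      replacing each end time by T, at distance at most N + k, without knowing the sign of
      c.\<close>
    define \<beta> where "\<beta> = - real N * (x0 \<bullet> (P *v x0)) + real N * (real (N + k) * \<bar>c\<bar>)
        + real N * (C1 * (real k * trace W)) + C * (norm x0)\<^sup>2"
    show "\<exists>\<beta>. \<forall>T\<ge>N+k. ennreal (((real N * avg_cost k - C * trace W) * real T - \<beta>) / (real N + C))
        \<le> STO_horizon A B Q R Qf x0 D k T"
    proof (intro exI[of _ \<beta>] allI impI)
      fix T assume T: "N + k \<le> T"
      \<comment> \<open>The last N end times for which all noise read by the forecasts still lies
        before T.\<close>
      define I where "I = {T - k - N..<T - k}"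
      have I: "card I = N" "finite I" "\<And>\<tau>. \<tau> \<in> I \<Longrightarrow> \<tau> + k < T" "\<And>\<tau>. \<tau> \<in> I \<Longrightarrow> T \<le> \<tau> + (N + k)"
        using T by (auto simp: I_def)
      define h :: "(nat \<Rightarrow> real^'d) \<Rightarrow> (nat \<Rightarrow> real^'n) \<Rightarrow> real" where
        "h u w = (\<Sum>\<tau>\<in>I. potential k w 0 x0 + (\<Sum>t<\<tau>. noise_cost k w t + innovation_cost k x0 u w t)
            - C1 * (\<Sum>i<k. (norm (w (\<tau> + i)))\<^sup>2)) - C * ((norm x0)\<^sup>2 + (\<Sum>t<T. (norm (w t))\<^sup>2))" for u w
      define m where "m = (\<Sum>\<tau>\<in>I. x0 \<bullet> (P *v x0) + (\<Sum>t<\<tau>. c + 0)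
            - C1 * (\<Sum>i<k. trace W)) - C * ((norm x0)\<^sup>2 + (\<Sum>t<T. trace W))"
      have "causal_sum k D T h m" unfolding h_def m_def c_def using I(3) T
        by (intro causal_sum_diff causal_sum_sum causal_sum_add causal_sum_scale causal_sum_potential
            causal_sum_noise_cost causal_sum_innovation_cost causal_sum_norm_sq causal_sum_const)
           force+
      from causal_sum_scale[OF this, of "1 / (N + C)"]
      have cs: "causal_sum k D T (\<lambda>u w. 1 / (N + C) * h u w) (1 / (N + C) * m)" .
      have le: "1 / (N + C) * h u w \<le> lqr_cost A B Q R Qf x0 T u w" for u w
      proof -
        let ?x = "trajectory A B x0 u w"
        let ?J = "lqr_cost A B Q R Qf x0 T u w"
        have J: "(\<Sum>t<T. stage (?x t) (u t)) \<le> ?J"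
          using Qf by (simp add: lqr_cost_def Let_def stage_def pos_semidef_def)
        have 1: "potential k w 0 x0 + (\<Sum>t<\<tau>. noise_cost k w t + innovation_cost k x0 u w t)
            - C1 * (\<Sum>i<k. (norm (w (\<tau> + i)))\<^sup>2) \<le> ?J + C1 * (norm (?x \<tau>))\<^sup>2" if "\<tau> \<in> I" for \<tau>
        proof -
          have "(\<Sum>t<\<tau>. stage (?x t) (u t)) \<le> (\<Sum>t<T. stage (?x t) (u t))"
            using I(3)[OF that] by (intro sum_mono2) (auto simp: stage_nonneg)
          moreover have "potential k w \<tau> (?x \<tau>) \<le> C1 * (norm (?x \<tau>))\<^sup>2 + C1 * (\<Sum>i<k. (norm (w (\<tau> + i)))\<^sup>2)"
            using C1(2)[of w \<tau> "?x \<tau>"] by (simp add: distrib_left)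
          moreover have "0 \<le> (\<Sum>t<\<tau>. input_error (?x t) (u t) (forecast k w t) \<bullet>
              (S *v input_error (?x t) (u t) (forecast k w t)))"
            by (intro sum_nonneg S0)
          ultimately show ?thesis using stage_sum[of x0 u w \<tau> k] J by linarith
        qed
        have "(\<Sum>\<tau>\<in>I. (norm (?x \<tau>))\<^sup>2) \<le> (\<Sum>t<T. (norm (?x t))\<^sup>2)"
          using I(3) by (intro sum_mono2) force+
        also have "\<dots> \<le> C2 * ((norm x0)\<^sup>2 + (\<Sum>t<T. stage (?x t) (u t)) + (\<Sum>t<T. (norm (w t))\<^sup>2))"
          using C2(2) unfolding stage_def .
        also have "\<dots> \<le> C2 * ((norm x0)\<^sup>2 + ?J + (\<Sum>t<T. (norm (w t))\<^sup>2))"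
          using J C2(1) by (intro mult_left_mono) auto
        finally have 2: "C1 * (\<Sum>\<tau>\<in>I. (norm (?x \<tau>))\<^sup>2) \<le> C * ((norm x0)\<^sup>2 + ?J + (\<Sum>t<T. (norm (w t))\<^sup>2))"
          using C1(1) unfolding C_def mult.assoc by (rule mult_left_mono)
        have "(\<Sum>\<tau>\<in>I. potential k w 0 x0 + (\<Sum>t<\<tau>. noise_cost k w t + innovation_cost k x0 u w t)
            - C1 * (\<Sum>i<k. (norm (w (\<tau> + i)))\<^sup>2)) \<le> (\<Sum>\<tau>\<in>I. ?J + C1 * (norm (?x \<tau>))\<^sup>2)"
          by (intro sum_mono 1)
        also have "\<dots> = N * ?J + C1 * (\<Sum>\<tau>\<in>I. (norm (?x \<tau>))\<^sup>2)"
          by (simp add: sum.distrib I sum_distrib_left)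
        \<comment> \<open>Each of the N end times contributes one copy of the cost, and
          detectability adds C more; hence the divisor N + C.\<close>
        finally have "h u w \<le> (N + C) * ?J" using 2 unfolding h_def by (simp add: algebra_simps)
        thus ?thesis using N C by (simp add: field_simps)
      qed
      have "(real N * c - C * trace W) * real T - \<beta> \<le> m"
      proof -
        have "real T * c - real (N + k) * \<bar>c\<bar> \<le> real \<tau> * c" if "\<tau> \<in> I" for \<tau>
        proof -
          have "(real T - real \<tau>) * c \<le> (real T - real \<tau>) * \<bar>c\<bar>"
            using I(3)[OF that] by (intro mult_left_mono) auto
          also have "\<dots> \<le> real (N + k) * \<bar>c\<bar>"
            using I(4)[OF that] by (intro mult_right_mono) auto
          finally show ?thesis by (simp add: algebra_simps)
        qed
        hence "(\<Sum>\<tau>\<in>I. x0 \<bullet> (P *v x0) + (real T * c - real (N + k) * \<bar>c\<bar>) - C1 * (real k * trace W)) \<le>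
           (\<Sum>\<tau>\<in>I. x0 \<bullet> (P *v x0) + real \<tau> * c - C1 * (real k * trace W))"
          by (intro sum_mono) auto
        moreover have "(\<Sum>\<tau>\<in>I. x0 \<bullet> (P *v x0) + (real T * c - real (N + k) * \<bar>c\<bar>) - C1 * (real k * trace W)) =
          real N * (x0 \<bullet> (P *v x0) + (real T * c - real (N + k) * \<bar>c\<bar>) - C1 * (real k * trace W))"
          by (simp add: I)
        ultimately show ?thesis unfolding m_def \<beta>_def by (simp add: algebra_simps)
      qed
      hence "((real N * c - C * trace W) * real T - \<beta>) / (N + C) \<le> 1 / (N + C) * m"
        using N C by (simp add: divide_right_mono)
      hence "ennreal (((real N * c - C * trace W) * real T - \<beta>) / (N + C)) \<le> ennreal (1 / (N + C) * m)"
        by (rule ennreal_leI)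
      also have "\<dots> \<le> STO_horizon A B Q R Qf x0 D k T"
        using T by (intro STO_horizon_ge[OF prob cs le]) auto
      finally show "ennreal (((real N * avg_cost k - C * trace W) * real T - \<beta>) / (real N + C))
        \<le> STO_horizon A B Q R Qf x0 D k T" by (simp add: c_def)
    qed
  qed
qed

section \<open>The cost of the predictive policy\<close>

definition predictive_policy :: "nat \<Rightarrow> real^'n \<Rightarrow> ('n, 'd) policy" where
  "predictive_policy k x0 = feedback_policy A B x0
     (\<lambda>t x v. - ((matrix_inv S ** transpose B) *v (P *v (A *v x) + forecast k v t)))"

lemma uses_predictions_predictive_policy:
  "uses_predictions k (predictive_policy k x0)"
proof -
  let ?g = "\<lambda>t x v. - ((matrix_inv S ** transpose B) *v (P *v (A *v x) + forecast k v t))"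
  have fc: "forecast k w t = forecast k w' t" if "\<forall>i<t+k. w i = w' i" for t w w'
    using that by (simp add: forecast_def)
  have cl: "closed_loop_state A B x0 ?g w t = closed_loop_state A B x0 ?g w' t"
    if "\<forall>i<t+k. w i = w' i" for t w w'
    using that
  proof (induction t)
    case (Suc t)
    have "\<forall>i<t+k. w i = w' i" "w t = w' t" using Suc.prems by auto
    thus ?case using Suc.IH fc[of t w w'] by simp
  qed simp
  show ?thesis unfolding uses_predictions_def predictive_policy_def feedback_policy_def
  proof (intro allI impI)
    fix t and w w' :: "nat \<Rightarrow> real^'n" assume *: "\<forall>i<t+k. w i = w' i"
    show "?g t (closed_loop_state A B x0 ?g w t) w = ?g t (closed_loop_state A B x0 ?g w' t) w'"
      unfolding cl[OF *] fc[OF *] ..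
  qed
qed

lemma input_error_predictive_policy:
  fixes w k x0
  defines "u \<equiv> \<lambda>t. predictive_policy k x0 t w"
  shows "input_error (trajectory A B x0 u w t) (u t) (forecast k w t) = 0"
proof -
  have "u t = - ((matrix_inv S ** transpose B) *v (P *v (A *v trajectory A B x0 u w t) + forecast k w t))"
    unfolding u_def predictive_policy_def by (rule feedback_policy_eq)
  thus ?thesis by (simp add: input_error_def flip: matrix_vector_mul_assoc)
qed

lemma closed_loop_recursion:
  fixes w k x0
  defines "x \<equiv> trajectory A B x0 (\<lambda>t. predictive_policy k x0 t w) w"
  shows "x (Suc t) = F *v x t + (w t - H *v forecast k w t)"
proof -
  have "predictive_policy k x0 t w = - (matrix_inv S *v (transpose B *v (P *v (A *v x t) + forecast k w t)))"
    using input_error_predictive_policy[of x0 k w t]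
    unfolding input_error_def x_def by (simp add: eq_neg_iff_add_eq_0)
  moreover have "B *v (- y) = - (B *v y)" for y
    using matrix_vector_mult_diff_distrib[of B 0 y] by simp
  ultimately show ?thesis unfolding x_def
    by (simp add: F_apply H_apply matrix_vector_right_distrib matrix_vector_mult_diff_distrib)
qed

text \<open>The closed loop is \<open>F\<close> driven by w - H y, so the Lyapunov inequality bounds
  the squared state by a recursively built majorant \<open>h\<close> of the noise alone. As a causal
  sum, \<open>h\<close> has an explicit mean, which stays below b uniformly in T.\<close>

lemma closed_loop_state_bound:
  fixes k x0
  defines "x \<equiv> \<lambda>w. trajectory A B x0 (\<lambda>t. predictive_policy k x0 t w) w"
  shows "\<exists>b. \<forall>T. \<exists>h m. causal_sum k D (T + k) (\<lambda>(u :: nat \<Rightarrow> real^'d) w. h w) m \<and> m \<le> b \<and>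
    (\<forall>w. (norm (x w T))\<^sup>2 \<le> h w)"
proof -
  obtain N where N: "\<And>x. norm (mat_pow F N *v x) \<le> norm x / 2" using F_contracts by blast
  obtain L r c where L: "0 \<le> r" "r < 1" "c \<ge> 0" "\<And>x. (norm x)\<^sup>2 \<le> L x" "\<And>x. L x \<le> c * (norm x)\<^sup>2"
    "\<And>x v. L (F *v x + v) \<le> r * L x + c * (norm v)\<^sup>2"
    using quadratic_lyapunov[OF N] by metis
  obtain d where d: "d \<ge> 0" "\<And>v. (norm (\<Sum>i<k. (H ** mat_pow (transpose F) i ** P) *v v i))\<^sup>2
       \<le> d * (\<Sum>i<k. (norm (v i))\<^sup>2)"
    using matrix_combination_sq_bound[of "\<lambda>i. H ** mat_pow (transpose F) i ** P" k] by blast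
  have v: "(norm (w t - H *v forecast k w t))\<^sup>2 \<le> 2 * (norm (w t))\<^sup>2 + 2 * (d * (\<Sum>i<k. (norm (w (t + i)))\<^sup>2))" for w t
  proof -
    have "H *v forecast k w t = (\<Sum>i<k. (H ** mat_pow (transpose F) i ** P) *v w (t + i))"
      by (simp add: forecast_def linear_sum[OF matrix_vector_mul_linear] flip: matrix_vector_mul_assoc)
    hence "(norm (H *v forecast k w t))\<^sup>2 \<le> d * (\<Sum>i<k. (norm (w (t + i)))\<^sup>2)"
      using d(2)[of "\<lambda>i. w (t + i)"] by simp
    thus ?thesis using norm_add_sq_le[of "w t" "- (H *v forecast k w t)"] by simp
  qed
  define e where "e = c * (2 * trace W + 2 * (d * (\<Sum>i<k. trace W)))"
  have e: "e \<ge> 0" unfolding e_def using L d trace_W_nonneg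
    by (intro mult_nonneg_nonneg add_nonneg_nonneg sum_nonneg) auto
  \<comment> \<open>The least bound above the initial value that is preserved by m -> r m +
    e.\<close>
  define b where "b = max (L x0) (e / (1 - r))"
  have "r * b + e \<le> b"
  proof -
    have "e \<le> (1 - r) * b" using L by (simp add: b_def field_simps max_def)
    thus ?thesis by (simp add: algebra_simps)
  qed
  have *: "\<exists>h m. causal_sum k D (T + k) (\<lambda>(u :: nat \<Rightarrow> real^'d) w. h w) m \<and> m \<le> b \<and> (\<forall>w. L (x w t) \<le> h w)"
    if "t \<le> T" for t T
    using that
  proof (induction t)
    case 0
    show ?case
      by (intro exI[of _ "\<lambda>w. L x0"] exI[of _ "L x0"]) (auto simp: x_def b_def causal_sum_const)
  next
    case (Suc t)
    then obtain h m where h: "causal_sum k D (T + k) (\<lambda>(u :: nat \<Rightarrow> real^'d) w. h w) m" "m \<le> b"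
      "\<And>w. L (x w t) \<le> h w" by auto
    let ?h = "\<lambda>w. r * h w + c * (2 * (norm (w t))\<^sup>2 + 2 * (d * (\<Sum>i<k. (norm (w (t + i)))\<^sup>2)))"
    have "causal_sum k D (T + k) (\<lambda>(u :: nat \<Rightarrow> real^'d) w. ?h w) (r * m + e)"
      unfolding e_def using Suc.prems
      by (intro causal_sum_add causal_sum_scale causal_sum_sum h causal_sum_norm_sq) auto
    moreover have "r * m + e \<le> b"
      using mult_left_mono[OF h(2) L(1)] \<open>r * b + e \<le> b\<close> by linarith
    moreover have "L (x w (Suc t)) \<le> ?h w" for w
    proof -
      have "L (x w (Suc t)) \<le> r * L (x w t) + c * (norm (w t - H *v forecast k w t))\<^sup>2"
        unfolding x_def closed_loop_recursion by (rule L(6))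
      also have "\<dots> \<le> ?h w"
        by (intro add_mono mult_left_mono h v L)
      finally show ?thesis .
    qed
    ultimately show ?case by (intro exI[of _ ?h] exI[of _ "r * m + e"]) blast
  qed
  show ?thesis
  proof (intro exI[of _ b] allI)
    fix T
    obtain h m where h: "causal_sum k D (T + k) (\<lambda>(u :: nat \<Rightarrow> real^'d) w. h w) m" "m \<le> b"
      "\<And>w. L (x w T) \<le> h w"
      using *[of T T] by blast
    have "(norm (x w T))\<^sup>2 \<le> h w" for w using order_trans[OF L(4) h(3)] .
    with h show "\<exists>h m. causal_sum k D (T + k) (\<lambda>(u :: nat \<Rightarrow> real^'d) w. h w) m \<and> m \<le> b \<and>
      (\<forall>w. (norm (x w T))\<^sup>2 \<le> h w)" by blast
  qed
qed

lemma lqr_cost_nonneg: "pos_semidef Qf \<Longrightarrow> 0 \<le> lqr_cost A B Q R Qf x0 T u w"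
  using sum_nonneg[of "{..<T}" "\<lambda>t. stage (trajectory A B x0 u w t) (u t)"]
  by (simp add: lqr_cost_def Let_def stage_nonneg pos_semidef_def flip: stage_def)

text \<open>With zero input error, \<open>stage_sum\<close> leaves the initial potential, the noise
  terms and end terms of bounded mean. The horizon of the causal sum is T + k because the potential
  at T reads k further noises.\<close>

lemma predictive_policy_upper:
  assumes Qf: "pos_semidef Qf"
  shows "\<exists>\<beta>. \<forall>T. \<exists>\<gamma>. 0 \<le> \<gamma> \<and> \<gamma> \<le> avg_cost k * real T + \<beta> \<and>
    nested_expectation D (T + k)
      (\<lambda>w. ennreal (lqr_cost A B Q R Qf x0 T (\<lambda>t. predictive_policy k x0 t w) w)) w0 \<le> ennreal \<gamma>"
proof -
  let ?\<pi> = "predictive_policy k x0"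
  let ?x = "\<lambda>w. trajectory A B x0 (\<lambda>t. ?\<pi> t w) w"
  obtain C1 where C1: "C1 \<ge> 0" "\<And>w t x. \<bar>potential k w t x\<bar> \<le> C1 * ((norm x)\<^sup>2 + (\<Sum>i<k. (norm (w (t + i)))\<^sup>2))"
    using potential_bound by blast
  obtain q where q: "q \<ge> 0" "\<And>x. \<bar>x \<bullet> (Qf *v x)\<bar> \<le> q * (norm x)\<^sup>2" using quadratic_form_bound by blast
  obtain b where b: "\<And>T. \<exists>h m. causal_sum k D (T + k) (\<lambda>(u :: nat \<Rightarrow> real^'d) w. h w) m \<and> m \<le> b \<and>
    (\<forall>w. (norm (?x w T))\<^sup>2 \<le> h w)" using closed_loop_state_bound by blast
  define \<beta> where "\<beta> = x0 \<bullet> (P *v x0) + (C1 + q) * b + C1 * (\<Sum>i<k. trace W)"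
  have "\<exists>\<gamma>. 0 \<le> \<gamma> \<and> \<gamma> \<le> avg_cost k * real T + \<beta> \<and>
    nested_expectation D (T + k) (\<lambda>w. ennreal (lqr_cost A B Q R Qf x0 T (\<lambda>t. ?\<pi> t w) w)) w0 \<le> ennreal \<gamma>" for T
  proof -
    obtain h m where h: "causal_sum k D (T + k) (\<lambda>(u :: nat \<Rightarrow> real^'d) w. h w) m" "m \<le> b"
      "\<And>w. (norm (?x w T))\<^sup>2 \<le> h w" using b[of T] by blast
    define g where "g u w = potential k w 0 x0 + (\<Sum>t<T. noise_cost k w t + innovation_cost k x0 u w t)
      + (C1 + q) * h w + C1 * (\<Sum>i<k. (norm (w (T + i)))\<^sup>2)" for u w
    define \<gamma> where "\<gamma> = x0 \<bullet> (P *v x0) + (\<Sum>t<T. avg_cost k + 0) + (C1 + q) * m + C1 * (\<Sum>i<k. trace W)"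
    have "causal_sum k D (T + k) g \<gamma>" unfolding g_def \<gamma>_def
      by (intro causal_sum_sum causal_sum_add causal_sum_scale causal_sum_potential
            causal_sum_noise_cost causal_sum_innovation_cost causal_sum_norm_sq h) auto
    hence "causal_sum k D (T + k) (\<lambda>(u :: nat \<Rightarrow> real^'d) w. g (\<lambda>t. ?\<pi> t w) w) \<gamma>"
      by (rule causal_sum_policy[OF _ uses_predictions_predictive_policy])
    then obtain f :: "nat \<Rightarrow> (nat \<Rightarrow> real^'d) \<Rightarrow> (nat \<Rightarrow> real^'n) \<Rightarrow> real" and c \<mu>
      where f: "\<And>n. n < T + k \<Longrightarrow> causal_term k D n (f n) (\<mu> n)"
        "\<And>u w. g (\<lambda>t. ?\<pi> t w) w = c + (\<Sum>n<T+k. f n u w)" "\<gamma> = c + (\<Sum>n<T+k. \<mu> n)"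
      unfolding causal_sum_def by blast
    have le: "lqr_cost A B Q R Qf x0 T (\<lambda>t. ?\<pi> t w) w \<le> g (\<lambda>t. ?\<pi> t w) w" for w
    proof -
      let ?u = "\<lambda>t. ?\<pi> t w"
      have "lqr_cost A B Q R Qf x0 T ?u w = (\<Sum>t<T. stage (?x w t) (?u t)) + ?x w T \<bullet> (Qf *v ?x w T)"
        by (simp add: lqr_cost_def Let_def stage_def)
      also have "\<dots> = potential k w 0 x0 + (\<Sum>t<T. noise_cost k w t + innovation_cost k x0 ?u w t)
          - potential k w T (?x w T) + ?x w T \<bullet> (Qf *v ?x w T)"
        using stage_sum[of x0 ?u w T k] by (simp add: input_error_predictive_policy)
      also have "\<dots> \<le> potential k w 0 x0 + (\<Sum>t<T. noise_cost k w t + innovation_cost k x0 ?u w t)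
          + ((C1 + q) * (norm (?x w T))\<^sup>2 + C1 * (\<Sum>i<k. (norm (w (T + i)))\<^sup>2))"
        using C1(2)[of w T "?x w T"] q(2)[of "?x w T"] by (simp add: algebra_simps)
      also have "\<dots> \<le> g ?u w"
        using mult_left_mono[OF h(3)[of w], of "C1 + q"] C1(1) q(1) unfolding g_def by linarith
      finally show ?thesis .
    qed
    \<comment> \<open>Any sequence may stand for \<open>u\<close> here, since after inserting the
      policy the sum no longer depends on it; it is nonnegative as a majorant of the cost.\<close>
    have nn: "0 \<le> c + (\<Sum>n<T+k. f n (\<lambda>_. 0) w)" for w
      using le[of w] lqr_cost_nonneg[OF Qf, of x0 T "\<lambda>t. ?\<pi> t w" w] f(2)[of w "\<lambda>_. 0"] by linarith
    have eq: "0 \<le> \<gamma>" "nested_expectation D (T + k) (\<lambda>w. ennreal (g (\<lambda>t. ?\<pi> t w) w)) w0 = ennreal \<gamma>"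
      using nested_expectation_eq[OF prob f(1) nn, where w = w0] unfolding f(2)[of _ "\<lambda>_. 0"] f(3) by auto
    have "nested_expectation D (T + k) (\<lambda>w. ennreal (lqr_cost A B Q R Qf x0 T (\<lambda>t. ?\<pi> t w) w)) w0 \<le> ennreal \<gamma>"
      unfolding eq(2)[symmetric] by (intro nested_expectation_mono ennreal_leI le)
    moreover have "\<gamma> \<le> avg_cost k * real T + \<beta>"
      unfolding \<gamma>_def \<beta>_def using mult_left_mono[OF h(2), of "C1 + q"] C1(1) q(1) by (simp add: mult.commute)
    ultimately show ?thesis using eq(1) by blast
  qed
  thus ?thesis by blast
qed

lemma borel_measurable_predictive_policy:
  "(\<lambda>w. predictive_policy k x0 t w) \<in> borel_measurable (PiM UNIV (\<lambda>_. borel))"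
proof -
  let ?g = "\<lambda>t x v. - ((matrix_inv S ** transpose B) *v (P *v (A *v x) + forecast k v t))"
  have fc[measurable]: "(\<lambda>w. forecast k w t) \<in> borel_measurable (PiM UNIV (\<lambda>_. borel))" for t
    unfolding forecast_def by measurable
  have [measurable]: "(\<lambda>w. closed_loop_state A B x0 ?g w t) \<in> borel_measurable (PiM UNIV (\<lambda>_. borel))" for t
    by (induction t) simp_all
  show ?thesis unfolding predictive_policy_def feedback_policy_def by measurable
qed

lemma borel_measurable_lqr_cost:
  assumes [measurable]: "\<And>t. (\<lambda>w. \<pi> t w) \<in> borel_measurable (PiM UNIV (\<lambda>_. borel))"
  shows "(\<lambda>w. lqr_cost A B Q R Qf x0 T (\<lambda>t. \<pi> t w) w) \<in> borel_measurable (PiM UNIV (\<lambda>_. borel))"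
proof -
  have [measurable]: "(\<lambda>w. trajectory A B x0 (\<lambda>t. \<pi> t w) w t) \<in> borel_measurable (PiM UNIV (\<lambda>_. borel))" for t
    by (induction t) simp_all
  show ?thesis unfolding lqr_cost_def Let_def by measurable
qed

lemma STO_horizon_le_policy:
  assumes "uses_predictions k \<pi>" "k \<le> T"
  shows "STO_horizon A B Q R Qf x0 D k T \<le>
    nested_expectation D (T + k) (\<lambda>w. ennreal (lqr_cost A B Q R Qf x0 T (\<lambda>t. \<pi> t w) w)) (\<lambda>_. 0)"
proof -
  have "nested_min D k (\<lambda>u w. ennreal (lqr_cost A B Q R Qf x0 T u w)) (T - k) 0 (\<lambda>_. 0) w \<le>
    iter_expectation D (T - k + k) (0 + k) (\<lambda>w. ennreal (lqr_cost A B Q R Qf x0 T (\<lambda>t. \<pi> t w) w)) w" for w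
    using assms by (intro nested_min_le_policy[OF prob, where T = T])
      (auto intro!: arg_cong[of _ _ ennreal] lqr_cost_noise_cong)
  hence "STO_horizon A B Q R Qf x0 D k T \<le> nested_expectation D k
    (iter_expectation D (T - k + k) (0 + k) (\<lambda>w. ennreal (lqr_cost A B Q R Qf x0 T (\<lambda>t. \<pi> t w) w))) (\<lambda>_. 0)"
    unfolding STO_horizon_def by (rule nested_expectation_mono)
  thus ?thesis using assms(2) by (simp add: nested_expectation_iter add.commute)
qed

end

text \<open>The asymmetry matches what is available: the averaging argument reaches only slopes
  below c, while the policy gives slope c exactly, up to a constant.\<close>

lemma has_long_run_averageI:
  assumes lower: "\<And>l. l < c \<Longrightarrow> \<forall>\<^sub>F T in sequentially. ennreal (l * real T) \<le> a T"
    and upper: "\<And>T. N \<le> T \<Longrightarrow> \<exists>\<gamma>. 0 \<le> \<gamma> \<and> \<gamma> \<le> c * real T + \<beta> \<and> a T \<le> ennreal \<gamma>"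
  shows "has_long_run_average a c"
  unfolding has_long_run_average_def
proof (rule order_tendstoI)
  fix y assume "y < ereal c"
  then obtain l where l: "y < ereal l" "ereal l < ereal c" using ereal_dense2 by blast
  have "\<forall>\<^sub>F T in sequentially. ennreal (l * real T) \<le> a T" using l by (intro lower) simp
  moreover have "\<forall>\<^sub>F T in sequentially. T > (0::nat)" by (rule eventually_gt_at_top)
  ultimately show "\<forall>\<^sub>F T in sequentially. y < enn2ereal (a T) / ereal (real T)"
  proof eventually_elim
    case (elim T)
    have "ereal (l * real T) \<le> enn2ereal (ennreal (l * real T))"
      by (cases "0 \<le> l * real T") (auto simp: ennreal_neg zero_ennreal.rep_eq)
    also have "\<dots> \<le> enn2ereal (a T)" using elim by (simp add: less_eq_ennreal.rep_eq)
    finally have "ereal l \<le> enn2ereal (a T) / ereal (real T)"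
      using elim by (simp add: ereal_le_divide_pos mult.commute)
    thus ?case using l by simp
  qed
next
  fix y assume "ereal c < y"
  then obtain l where l: "ereal c < ereal l" "ereal l < y" using ereal_dense2 by blast
  have "filterlim (\<lambda>T. (l - c) * real T) at_top sequentially"
    using l by (intro filterlim_tendsto_pos_mult_at_top[OF tendsto_const]) (auto simp: filterlim_real_sequentially)
  hence "\<forall>\<^sub>F T in sequentially. \<beta> \<le> (l - c) * real T" by (simp add: filterlim_at_top)
  moreover have "\<forall>\<^sub>F T in sequentially. T > (0::nat)" by (rule eventually_gt_at_top)
  moreover have "\<forall>\<^sub>F T in sequentially. T \<ge> N" by (rule eventually_ge_at_top)
  ultimately show "\<forall>\<^sub>F T in sequentially. enn2ereal (a T) / ereal (real T) < y"
  proof eventually_elim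
    case (elim T)
    obtain \<gamma> where \<gamma>: "0 \<le> \<gamma>" "\<gamma> \<le> c * real T + \<beta>" "a T \<le> ennreal \<gamma>" using upper elim by blast
    have "enn2ereal (a T) \<le> enn2ereal (ennreal \<gamma>)" using \<gamma> by (simp add: less_eq_ennreal.rep_eq)
    also have "\<dots> = ereal \<gamma>" using \<gamma> by simp
    also have "\<dots> \<le> ereal (l * real T)" using \<gamma> elim by (simp add: algebra_simps)
    finally have "enn2ereal (a T) / ereal (real T) \<le> ereal l"
      using elim by (simp add: ereal_divide_le_pos mult.commute)
    thus ?case using l by simp
  qed
qed

text \<open>The slope (N c - C s) / (N + C) tends to c, so some fixed N beats l; afterwards a large
  T absorbs the constant belonging to that N.\<close>

lemma averaged_lower_bound:
  fixes a :: "nat \<Rightarrow> ennreal"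
  assumes C: "C \<ge> 0"
    and le: "\<And>N. N \<ge> 1 \<Longrightarrow> \<exists>\<beta>. \<forall>T\<ge>N+k. ennreal (((real N * c - C * s) * real T - \<beta>) / (real N + C)) \<le> a T"
    and "l < c"
  shows "\<forall>\<^sub>F T in sequentially. ennreal (l * real T) \<le> a T"
proof -
  have "((\<lambda>N. (c - C * s * inverse (real N)) / (1 + C * inverse (real N))) \<longlongrightarrow> (c - C * s * 0) / (1 + C * 0)) sequentially"
    by (intro tendsto_intros LIMSEQ_inverse_real_of_nat lim_inverse_n) auto
  hence "\<forall>\<^sub>F N in sequentially. l < (c - C * s * inverse (real N)) / (1 + C * inverse (real N))"
    using \<open>l < c\<close> by (intro order_tendstoD) auto
  moreover have "\<forall>\<^sub>F N in sequentially. N \<ge> (1::nat)" by (rule eventually_ge_at_top)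
  ultimately have "\<forall>\<^sub>F N in sequentially. N \<ge> 1 \<and> l < (c - C * s * inverse (real N)) / (1 + C * inverse (real N))"
    by eventually_elim auto
  then obtain N where N: "N \<ge> 1" "l < (c - C * s * inverse (real N)) / (1 + C * inverse (real N))"
    using eventually_happens'[OF sequentially_bot] by blast
  \<comment> \<open>The excess of the slope over l, multiplied by N + C; the claim at T then amounts
    to \<beta> <= d T.\<close>
  define d where "d = real N * c - C * s - l * (real N + C)"
  have pos: "real N + C > 0" using N C by linarith
  have "(c - C * s * inverse (real N)) / (1 + C * inverse (real N)) = (real N * c - C * s) / (real N + C)"
    using N C pos by (simp add: divide_simps)
  hence "l < (real N * c - C * s) / (real N + C)" using N(2) by (simp only:)
  hence d: "d > 0" using pos by (simp add: d_def pos_less_divide_eq)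
  obtain \<beta> where \<beta>: "\<And>T. T \<ge> N + k \<Longrightarrow> ennreal (((real N * c - C * s) * real T - \<beta>) / (real N + C)) \<le> a T"
    using le[OF N(1)] by blast
  have "filterlim (\<lambda>T. d * real T) at_top sequentially"
    using d by (intro filterlim_tendsto_pos_mult_at_top[OF tendsto_const]) (auto simp: filterlim_real_sequentially)
  hence "\<forall>\<^sub>F T in sequentially. \<beta> \<le> d * real T" by (simp add: filterlim_at_top)
  moreover have "\<forall>\<^sub>F T in sequentially. T \<ge> N + k" by (rule eventually_ge_at_top)
  ultimately show ?thesis
  proof eventually_elim
    case (elim T)
    have "l * real T \<le> ((real N * c - C * s) * real T - \<beta>) / (real N + C)"
      using elim pos by (simp add: d_def field_simps)
    hence "ennreal (l * real T) \<le> ennreal (((real N * c - C * s) * real T - \<beta>) / (real N + C))"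
      by (rule ennreal_leI)
    also have "\<dots> \<le> a T" using \<beta> elim by blast
    finally show ?case .
  qed
qed

theorem theorem3p2:
  fixes A Q Qf P H W :: "real^'n^'n"
    and B :: "real^'d^'n"
    and R :: "real^'d^'d"
    and x0 :: "real^'n"
    and M :: "'a measure"
    and w :: "nat \<Rightarrow> 'a \<Rightarrow> real^'n"
    and k :: nat
  assumes "pos_semidef Q" and "pos_semidef Qf" and "pos_def R"
    and "stabilizable A B" and "detectable A Q"
    and "riccati_solution A B Q R P"
    and "H = B ** matrix_inv (R + transpose B ** P ** B) ** transpose B"
    and "prob_space M"
    and "prob_space.indep_vars M (\<lambda>_. borel) w UNIV"
    and "\<And>t. distr M borel (w t) = distr M borel (w 0)"
    and "\<And>t. integrable M (\<lambda>\<omega>. (norm (w t \<omega>))\<^sup>2)"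
    and "\<And>t. (\<integral>\<omega>. w t \<omega> \<partial>M) = 0"
    and "\<And>t. covariance_matrix M (w t) = W"
    and "k \<ge> 1"
  shows "optimal_policy A B Q R Qf x0 M w k
           (feedback_policy A B x0 (\<lambda>t x v.
              - ((matrix_inv (R + transpose B ** P ** B) ** transpose B) *v
                (P *v (A *v x) +
                 (\<Sum>i<k. mat_pow (transpose A - transpose A ** P ** H) i *v (P *v v (t + i)))))))
       \<and> has_long_run_average (STO_horizon A B Q R Qf x0 (\<lambda>t. distr M borel (w t)) k)
           (trace ((P - (\<Sum>i<k. P ** mat_pow (A - H ** P ** A) i ** H **
                                 mat_pow (transpose A - transpose A ** P ** H) i ** P)) ** W))"
proof -
  interpret prob_space M by fact
  interpret sys: lqr A Q P B R using assms by unfold_locales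
  let ?D = "\<lambda>t. distr M borel (w t)"
  have wm[measurable]: "w t \<in> borel_measurable M" for t using assms(9) by (simp add: indep_vars_def2)
  have int: "integrable M (w t)" for t
    by (rule square_integrable_imp_integrable_vector[OF assms(8) wm assms(11)])
  have comp0: "(\<integral>\<omega>. w t \<omega> $ i \<partial>M) = 0" for t i
    using integral_inner_left[OF int, of t "axis i 1"] assms(12)[of t] by (simp add: inner_axis)
  have cov: "(\<integral>\<omega>. w t \<omega> $ i * w t \<omega> $ j \<partial>M) = W $ i $ j" for t i j
    using assms(13)[of t] by (auto simp: covariance_matrix_def comp0)
  interpret noise: lqr_noise A Q P B R ?D W
  proof (intro lqr_noise.intro lqr_noise_axioms.intro sys.lqr_axioms)
    fix t i j
    show "prob_space (?D t)" by (rule prob_space_distr) simp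
    show "sets (?D t) = sets borel" by simp
    show "integrable (?D t) (\<lambda>z. (norm z)\<^sup>2)" using assms(11)[of t] by (simp add: integrable_distr_eq)
    show "(\<integral>z. z \<partial>?D t) = 0" using assms(12)[of t] by (simp add: integral_distr)
    show "(\<integral>z. z $ i * z $ j \<partial>?D t) = W $ i $ j" using cov[of t i j] by (subst integral_distr) auto
  qed
  have H: "H = sys.H" by (simp add: assms(7) sys.H_def sys.S_def)
  have Ft: "transpose A - transpose A ** P ** H = transpose sys.F" by (simp add: H sys.transpose_F)
  have F: "A - H ** P ** A = sys.F" by (simp add: H sys.F_def)
  define \<pi> where "\<pi> = noise.predictive_policy k x0"
  have \<pi>: "feedback_policy A B x0 (\<lambda>t x v. - ((matrix_inv (R + transpose B ** P ** B) ** transpose B) *v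
      (P *v (A *v x) + (\<Sum>i<k. mat_pow (transpose A - transpose A ** P ** H) i *v (P *v v (t + i)))))) = \<pi>"
    unfolding \<pi>_def noise.predictive_policy_def Ft sys.forecast_def sys.S_def ..
  have c: "trace ((P - (\<Sum>i<k. P ** mat_pow (A - H ** P ** A) i ** H **
      mat_pow (transpose A - transpose A ** P ** H) i ** P)) ** W) = noise.avg_cost k"
    by (simp only: noise.avg_cost_def Ft F flip: H)
  have up: "uses_predictions k \<pi>"
    unfolding \<pi>_def by (rule noise.uses_predictions_predictive_policy)
  let ?STO = "STO_horizon A B Q R Qf x0 ?D k"
  let ?J = "\<lambda>T v. ennreal (lqr_cost A B Q R Qf x0 T (\<lambda>t. \<pi> t v) v)"
  have cost: "policy_cost A B Q R Qf x0 M w \<pi> T = nested_expectation ?D (T + k) (?J T) (\<lambda>_. 0)" for T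
    unfolding policy_cost_def
  \<comment> \<open>The inputs before T may read predictions beyond T, so more than T noises have to
    be integrated.\<close>
  proof (rule nested_expectation_eq_nn_integral[OF assms(8,9), symmetric])
    show "?J T \<in> borel_measurable (PiM UNIV (\<lambda>_. borel))"
      using noise.borel_measurable_lqr_cost noise.borel_measurable_predictive_policy
      unfolding \<pi>_def by measurable
    fix v v' :: "nat \<Rightarrow> real^'n" assume v: "\<And>i. i < T + k \<Longrightarrow> v i = v' i"
    have "\<pi> t v = \<pi> t v'" if "t < T" for t
      using up v that unfolding uses_predictions_def by (meson add_less_mono1 less_trans)
    hence "lqr_cost A B Q R Qf x0 T (\<lambda>t. \<pi> t v) v = lqr_cost A B Q R Qf x0 T (\<lambda>t. \<pi> t v') v"
    proof -
      assume \<pi>_eq: "\<And>t. t < T \<Longrightarrow> \<pi> t v = \<pi> t v'"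
      have "trajectory A B x0 (\<lambda>t. \<pi> t v) v t = trajectory A B x0 (\<lambda>t. \<pi> t v') v t" if "t \<le> T" for t
        using that \<pi>_eq by (intro trajectory_cong) auto
      thus ?thesis using \<pi>_eq unfolding lqr_cost_def Let_def
        by (intro arg_cong2[of _ _ _ _ "(+)"] sum.cong) auto
    qed
    also have "\<dots> = lqr_cost A B Q R Qf x0 T (\<lambda>t. \<pi> t v') v'"
      using v by (intro lqr_cost_noise_cong) auto
    finally show "?J T v = ?J T v'" by simp
  qed
  obtain \<beta> where \<beta>: "\<And>T. \<exists>\<gamma>. 0 \<le> \<gamma> \<and> \<gamma> \<le> noise.avg_cost k * real T + \<beta> \<and>
      policy_cost A B Q R Qf x0 M w \<pi> T \<le> ennreal \<gamma>"
    using noise.predictive_policy_upper[OF assms(2), of k x0 "\<lambda>_. 0"]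
    unfolding \<pi>_def[symmetric] cost[symmetric] by blast
  \<comment> \<open>This inequality closes a squeeze: the lower bound for the optimum carries over
    to the policy, the upper bound for the policy to the optimum, and both averages converge to the
    same value.\<close>
  have le: "?STO T \<le> policy_cost A B Q R Qf x0 M w \<pi> T" if "k \<le> T" for T
    unfolding cost by (rule noise.STO_horizon_le_policy[OF up that])
  obtain C where C: "C \<ge> 0" "\<And>N. N \<ge> 1 \<Longrightarrow> \<exists>\<beta>. \<forall>T\<ge>N+k.
      ennreal (((real N * noise.avg_cost k - C * trace W) * real T - \<beta>) / (real N + C)) \<le> ?STO T"
    using noise.STO_horizon_lower[OF assms(2)] by blast
  have lower: "\<forall>\<^sub>F T in sequentially. ennreal (l * real T) \<le> ?STO T" if "l < noise.avg_cost k" for l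
    by (rule averaged_lower_bound[OF C that])
  have sto: "has_long_run_average ?STO (noise.avg_cost k)"
  proof (rule has_long_run_averageI[OF lower])
    fix T assume "k \<le> T"
    from le[OF this] \<beta>[of T]
    show "\<exists>\<gamma>. 0 \<le> \<gamma> \<and> \<gamma> \<le> noise.avg_cost k * real T + \<beta> \<and> ?STO T \<le> ennreal \<gamma>"
      using order_trans by blast
  qed
  have "has_long_run_average (policy_cost A B Q R Qf x0 M w \<pi>) (noise.avg_cost k)"
  proof (rule has_long_run_averageI[of _ _ 0])
    fix l assume "l < noise.avg_cost k"
    from lower[OF this] show "\<forall>\<^sub>F T in sequentially. ennreal (l * real T) \<le> policy_cost A B Q R Qf x0 M w \<pi> T"
      using eventually_ge_at_top[of k] by eventually_elim (use le order_trans in blast)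
  qed (use \<beta> in blast)
  with sto up show ?thesis unfolding \<pi> c optimal_policy_def by blast
qed

end
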